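(* Let $P=\{p_1,\ldots,p_n\}\subset\mathbb{R}^d$ and let $y\in\mathbb{R}^d$ be such that every simplex in $\mathrm{cov}_P(y)$ is $d$-dimensional. Let $M$ be a closed PL manifold of dimension $m\ge d$ and $T$ a triangulation of $M$. Then for every labelling $L:V(T)\to\{1,\ldots,n\}$, the set $S:=f_{L,P}^{-1}(y)$ is a null-cobordant manifold of dimension $m-d$.
   Context: $\mathrm{cov}_P(y)$ is the set of all simplices $\mathrm{conv}(p_{i_1},\ldots,p_{i_k})$, $1\le k\le d+1$, spanned by points of $P$ that contain $y$. $f_{L,P}:M\to\mathbb{R}^d$ is the piecewise linear map sending each vertex $v$ of $T$ to $p_{L(v)}$, extended linearly on each simplex of $T$. A manifold is null-cobordant if it is the entire boundary of some compact manifold of one dimension higher (the empty manifold counts as null-cobordant). *)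

theory Defs
  imports "HOL-Analysis.Analysis"
begin

section \<open>Simplices with vertices in a point set that contain a given point\<close>

text \<open>The number of spanning points is at most \<open>d + 1\<close>, where \<open>d\<close> is the dimension of the
  ambient space. Simplices are nondegenerate, as in \<^const>\<open>simplex\<close>.\<close>

definition cov :: "'a::euclidean_space set \<Rightarrow> 'a \<Rightarrow> 'a set set"
  where "cov P y = {convex hull C | C.
           C \<subseteq> P \<and> 1 \<le> card C \<and> card C \<le> DIM('a) + 1 \<and> \<not> affine_dependent C \<and>
           y \<in> convex hull C}"

section \<open>Piecewise linear manifolds\<close>

text \<open>Piecewise linear means: continuous, and every point of the domain has a neighbourhood in
  the domain that is covered by finitely many polytopes in the domain, on each of which the map is
  affine. In particular the domain is then a (not necessarily compact) polyhedron in the sense of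
  PL topology, which is not the sense of the library constant \<^const>\<open>polyhedron\<close>.\<close>

definition pl_on :: "'a::euclidean_space set \<Rightarrow> ('a \<Rightarrow> 'b::euclidean_space) \<Rightarrow> bool"
  where "pl_on X f \<longleftrightarrow> continuous_on X f \<and>
    (\<forall>x\<in>X. \<exists>\<C> U. finite \<C> \<and>
       (\<forall>C\<in>\<C>. polytope C \<and> C \<subseteq> X \<and> (\<exists>A b. linear A \<and> (\<forall>z\<in>C. f z = A z + b))) \<and>
       openin (top_of_set X) U \<and> x \<in> U \<and> U \<subseteq> \<Union>\<C>)"

definition pl_homeomorphism ::
    "'a::euclidean_space set \<Rightarrow> 'b::euclidean_space set \<Rightarrow> ('a \<Rightarrow> 'b) \<Rightarrow> ('b \<Rightarrow> 'a) \<Rightarrow> bool"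
  where "pl_homeomorphism X Y f g \<longleftrightarrow> homeomorphism X Y f g \<and> pl_on X f \<and> pl_on Y g"

text \<open>PL manifolds are polyhedra in some Euclidean space that are locally PL homeomorphic to an
  open subset of \<open>\<real>\<^sup>k\<close> or of a half-space of \<open>\<real>\<^sup>k\<close>. As \<open>k\<close> is a number and not a type, a
  \<open>k\<close>-dimensional linear subspace \<open>V\<close> of the ambient space plays the role of \<open>\<real>\<^sup>k\<close>; this is no
  restriction, since a nonempty \<open>k\<close>-manifold only fits into a space of dimension at least \<open>k\<close>.\<close>

definition pl_interior_point :: "nat \<Rightarrow> 'a::euclidean_space set \<Rightarrow> 'a \<Rightarrow> bool"
  where "pl_interior_point k X x \<longleftrightarrow>
    (\<exists>N V U f g. openin (top_of_set X) N \<and> x \<in> N \<and>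
       subspace V \<and> dim V = k \<and>
       openin (top_of_set (V :: 'a set)) U \<and> pl_homeomorphism N U f g)"

definition pl_boundary_point :: "nat \<Rightarrow> 'a::euclidean_space set \<Rightarrow> 'a \<Rightarrow> bool"
  where "pl_boundary_point k X x \<longleftrightarrow>
    (\<exists>N V a U f g. openin (top_of_set X) N \<and> x \<in> N \<and>
       subspace V \<and> dim V = k \<and> a \<in> V \<and> a \<noteq> 0 \<and>
       openin (top_of_set {v \<in> (V :: 'a set). 0 \<le> a \<bullet> v}) U \<and>
       pl_homeomorphism N U f g \<and> a \<bullet> f x = 0)"

definition pl_manifold_with_boundary :: "nat \<Rightarrow> 'a::euclidean_space set \<Rightarrow> bool"
  where "pl_manifold_with_boundary k X \<longleftrightarrow>
    (\<forall>x\<in>X. pl_interior_point k X x \<or> pl_boundary_point k X x)"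

definition pl_boundary :: "nat \<Rightarrow> 'a::euclidean_space set \<Rightarrow> 'a set"
  where "pl_boundary k X = {x \<in> X. pl_boundary_point k X x}"

definition closed_pl_manifold :: "nat \<Rightarrow> 'a::euclidean_space set \<Rightarrow> bool"
  where "closed_pl_manifold k X \<longleftrightarrow>
    compact X \<and> pl_manifold_with_boundary k X \<and> pl_boundary k X = {}"

text \<open>The bounding manifold \<open>W\<close> is required to lie in the same ambient Euclidean space as \<open>X\<close>
  (HOL cannot quantify existentially over the dimension type of the ambient space). So the
  predicate is at least as strong as null-cobordance through an abstract \<open>W\<close>.\<close>

definition null_cobordant_manifold :: "nat \<Rightarrow> 'a::euclidean_space set \<Rightarrow> bool"
  where "null_cobordant_manifold k X \<longleftrightarrow> closed_pl_manifold k X \<and>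
    (\<exists>W. compact W \<and> pl_manifold_with_boundary (k + 1) W \<and> pl_boundary (k + 1) W = X)"

section \<open>Triangulations and the map induced by a labelling\<close>

text \<open>A triangulation of \<open>M\<close> is a simplicial complex together with a PL homeomorphism \<open>h\<close> from its
  underlying polyhedron onto \<open>M\<close>; the simplices of the triangulation of \<open>M\<close> are the images
  \<open>h ` \<sigma>\<close>. The case in which \<open>M\<close> is the polyhedron of the complex is \<open>h = id\<close>.\<close>

definition pl_triangulation ::
    "'b::euclidean_space set set \<Rightarrow> ('b \<Rightarrow> 'a::euclidean_space) \<Rightarrow> 'a set \<Rightarrow> bool"
  where "pl_triangulation T h M \<longleftrightarrow>
    simplicial_complex T \<and> (\<exists>g. pl_homeomorphism (\<Union>T) M h g)"

definition vertices :: "'b::euclidean_space set set \<Rightarrow> 'b set"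
  where "vertices T = {v. {v} \<in> T}"

text \<open>Extension of \<open>q\<close> from the vertices of \<open>T\<close> to its polyhedron, by barycentric coordinates
  \<open>u\<close> in each simplex. By the lemma below the value is well defined.\<close>

definition linear_extension ::
    "'b::euclidean_space set set \<Rightarrow> ('b \<Rightarrow> 'c::real_vector) \<Rightarrow> 'b \<Rightarrow> 'c"
  where "linear_extension T q x =
    (THE z. \<exists>\<sigma>\<in>T. \<exists>u. (\<forall>v. v extreme_point_of \<sigma> \<longrightarrow> 0 \<le> u v) \<and>
        (\<Sum>v | v extreme_point_of \<sigma>. u v) = 1 \<and>
        x = (\<Sum>v | v extreme_point_of \<sigma>. u v *\<^sub>R v) \<and>
        z = (\<Sum>v | v extreme_point_of \<sigma>. u v *\<^sub>R q v))"

lemma barycentric_support: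
  fixes C :: "'b::euclidean_space set" and u :: "'b \<Rightarrow> real"
  assumes C: "\<not> affine_dependent C" and D: "D \<subseteq> C"
    and u: "\<And>v. v \<in> C \<Longrightarrow> 0 \<le> u v" "sum u C = 1"
    and x: "(\<Sum>v\<in>C. u v *\<^sub>R v) \<in> convex hull D"
  shows "\<forall>v\<in>C - D. u v = 0"
proof -
  have fC: "finite C" using C by (rule aff_independent_finite)
  then have fD: "finite D" using D finite_subset by blast
  have "\<exists>w. (\<forall>v\<in>D. 0 \<le> w v) \<and> sum w D = 1 \<and>
      (\<Sum>v\<in>D. w v *\<^sub>R v) = (\<Sum>v\<in>C. u v *\<^sub>R v)"
    using x unfolding convex_hull_finite[OF fD] by (rule CollectD)
  then obtain w where w: "sum w D = 1" "(\<Sum>v\<in>D. w v *\<^sub>R v) = (\<Sum>v\<in>C. u v *\<^sub>R v)"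
    by blast
  define w' where "w' v = (if v \<in> D then w v else 0)" for v
  have s1: "sum w' C = sum w D"
    using D fC unfolding w'_def by (simp add: sum.If_cases Int_absorb1)
  have s2: "(\<Sum>v\<in>C. w' v *\<^sub>R v) = (\<Sum>v\<in>D. w v *\<^sub>R v)"
  proof -
    have "(\<Sum>v\<in>C. w' v *\<^sub>R v) = (\<Sum>v\<in>D. w' v *\<^sub>R v)"
      by (rule sum.mono_neutral_right[OF fC D]) (auto simp: w'_def)
    then show ?thesis by (simp add: w'_def)
  qed
  have "\<forall>v\<in>C. u v - w' v = 0"
  proof (rule ccontr)
    assume "\<not> (\<forall>v\<in>C. u v - w' v = 0)"
    moreover have "sum (\<lambda>v. u v - w' v) C = 0"
      using u(2) w(1) s1 by (simp add: sum_subtractf)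
    moreover have "(\<Sum>v\<in>C. (u v - w' v) *\<^sub>R v) = 0"
      using w(2) s2 by (simp add: sum_subtractf scaleR_diff_left)
    ultimately have "affine_dependent C"
      unfolding affine_dependent_explicit_finite[OF fC] by blast
    with C show False by blast
  qed
  then show ?thesis by (force simp: w'_def)
qed

lemma linear_extension_eq:
  fixes T :: "'b::euclidean_space set set" and u :: "'b \<Rightarrow> real"
  assumes T: "simplicial_complex T" and CT: "convex hull C \<in> T" and C: "\<not> affine_dependent C"
    and u: "\<And>v. v \<in> C \<Longrightarrow> 0 \<le> u v" "sum u C = 1"
  shows "linear_extension T q (\<Sum>v\<in>C. u v *\<^sub>R v) = (\<Sum>v\<in>C. u v *\<^sub>R q v)"
  unfolding linear_extension_def
proof (rule the_equality)
  have ext: "{v. v extreme_point_of convex hull B} = B" if "\<not> affine_dependent B" for B :: "'b set"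
    using that by (auto simp: extreme_point_of_convex_hull_affine_independent)
  let ?x = "\<Sum>v\<in>C. u v *\<^sub>R v"
  show "\<exists>\<sigma>\<in>T. \<exists>w. (\<forall>v. v extreme_point_of \<sigma> \<longrightarrow> 0 \<le> w v) \<and>
        (\<Sum>v | v extreme_point_of \<sigma>. w v) = 1 \<and>
        ?x = (\<Sum>v | v extreme_point_of \<sigma>. w v *\<^sub>R v) \<and>
        (\<Sum>v\<in>C. u v *\<^sub>R q v) = (\<Sum>v | v extreme_point_of \<sigma>. w v *\<^sub>R q v)"
    using CT u ext[OF C]
    by (intro bexI[of _ "convex hull C"] exI[of _ u])
      (auto simp: extreme_point_of_convex_hull_affine_independent[OF C])
  fix z
  assume "\<exists>\<sigma>\<in>T. \<exists>w. (\<forall>v. v extreme_point_of \<sigma> \<longrightarrow> 0 \<le> w v) \<and>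
        (\<Sum>v | v extreme_point_of \<sigma>. w v) = 1 \<and>
        ?x = (\<Sum>v | v extreme_point_of \<sigma>. w v *\<^sub>R v) \<and>
        z = (\<Sum>v | v extreme_point_of \<sigma>. w v *\<^sub>R q v)"
  then obtain \<sigma> w where s: "\<sigma> \<in> T" and w0: "\<forall>v. v extreme_point_of \<sigma> \<longrightarrow> 0 \<le> w v"
    "(\<Sum>v | v extreme_point_of \<sigma>. w v) = 1"
    "?x = (\<Sum>v | v extreme_point_of \<sigma>. w v *\<^sub>R v)"
    "z = (\<Sum>v | v extreme_point_of \<sigma>. w v *\<^sub>R q v)" by blast
  obtain B where B: "\<not> affine_dependent B" "\<sigma> = convex hull B"
    using T s unfolding simplicial_complex_def simplex_def by meson
  note w = w0[unfolded B(2) ext[OF B(1)]]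
  have w1: "\<And>v. v \<in> B \<Longrightarrow> 0 \<le> w v"
    using w(1) extreme_point_of_convex_hull_affine_independent[OF B(1)] by blast
  have fin: "finite B" "finite C" using B(1) C aff_independent_finite by auto
  let ?F = "convex hull C \<inter> convex hull B"
  have F: "?F face_of convex hull C" "?F face_of convex hull B"
  proof -
    have *: "S \<inter> S' face_of S" if "S \<in> T" "S' \<in> T" for S S'
      using T that unfolding simplicial_complex_def by blast
    show "?F face_of convex hull C" using *[OF CT] s B(2) by blast
    show "?F face_of convex hull B" using *[OF _ CT] s B(2) by (simp add: Int_commute)
  qed
  obtain D where D: "D \<subseteq> C" "?F = convex hull D"
    using F(1) face_of_convex_hull_affine_independent[OF C] by auto
  obtain E where E: "E \<subseteq> B" "?F = convex hull E"
    using F(2) face_of_convex_hull_affine_independent[OF B(1)] by auto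
  have iD: "\<not> affine_dependent D" and iE: "\<not> affine_dependent E"
    using C B(1) D(1) E(1) affine_independent_subset by blast+
  have DE: "D = E" using ext[OF iD] ext[OF iE] D(2) E(2) by simp
  have "?x \<in> convex hull C"
    using u by (auto simp: convex_hull_finite[OF fin(2)])
  moreover have "?x \<in> convex hull B"
    using w1 w(2,3) by (auto simp: convex_hull_finite[OF fin(1)])
  ultimately have xD: "?x \<in> convex hull D" using D(2) by blast
  have a: "\<forall>v\<in>C - D. u v = 0"
    by (rule barycentric_support[OF C D(1) u xD])
  have xE: "(\<Sum>v\<in>B. w v *\<^sub>R v) \<in> convex hull D" using xD w(3) by simp
  have b: "\<forall>v\<in>B - D. w v = 0"
    by (rule barycentric_support[OF B(1) E(1)[folded DE] w1 w(2) xE])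
  have DB: "D \<subseteq> B" using E(1) DE by simp
  have fD: "finite D" using iD by (rule aff_independent_finite)
  have sums: "sum u C = sum u D" "?x = (\<Sum>v\<in>D. u v *\<^sub>R v)"
    using a by (auto intro!: sum.mono_neutral_right[OF fin(2) D(1)])
  have sums': "sum w B = sum w D" "(\<Sum>v\<in>B. w v *\<^sub>R v) = (\<Sum>v\<in>D. w v *\<^sub>R v)"
    using b by (auto intro!: sum.mono_neutral_right[OF fin(1) DB])
  have ab: "u v = w v" if v: "v \<in> D" for v
  proof (rule ccontr)
    assume ne: "u v \<noteq> w v"
    have "sum (\<lambda>v. u v - w v) D = 0"
      unfolding sum_subtractf using u(2) w(2) sums(1) sums'(1) by linarith
    moreover have "(\<Sum>v\<in>D. (u v - w v) *\<^sub>R v) = 0"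
      unfolding scaleR_diff_left sum_subtractf
      using trans[OF trans[OF sums(2)[symmetric] w(3)] sums'(2)] by simp
    moreover have "\<exists>v\<in>D. u v - w v \<noteq> 0" using v ne by auto
    ultimately have "affine_dependent D"
      unfolding affine_dependent_explicit_finite[OF fD] by blast
    with iD show False by blast
  qed
  have "z = (\<Sum>v\<in>D. w v *\<^sub>R q v)"
    unfolding w(4) using DB b by (intro sum.mono_neutral_right fin) auto
  also have "\<dots> = (\<Sum>v\<in>D. u v *\<^sub>R q v)"
    using ab by (intro sum.cong) auto
  also have "\<dots> = (\<Sum>v\<in>C. u v *\<^sub>R q v)"
    using D(1) a by (intro sum.mono_neutral_left fin) auto
  finally show "z = (\<Sum>v\<in>C. u v *\<^sub>R q v)" .
qed

text \<open>The map \<open>f\<^bsub>L,P\<^esub> : M \<rightarrow> \<real>\<^sup>d\<close> for the triangulation \<open>(T, h)\<close> of \<open>M = h ` \<Union>T\<close> and the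
  points \<open>p 1, \<dots>, p n\<close>.\<close>

definition label_map ::
    "'b::euclidean_space set set \<Rightarrow> ('b \<Rightarrow> 'a::euclidean_space) \<Rightarrow> ('b \<Rightarrow> nat) \<Rightarrow>
     (nat \<Rightarrow> 'c::real_vector) \<Rightarrow> 'a \<Rightarrow> 'c"
  where "label_map T h L p x = linear_extension T (\<lambda>v. p (L v)) (inv_into (\<Union>T) h x)"

end

theory Submission
  imports Defs
begin

text \<open>
  Let \<open>f\<close> be the simplexwise linear map and let \<open>v\<close> be a generic direction. The preimage \<open>W\<close> of the ray
  from \<open>y\<close> in direction \<open>v\<close> is compact and is bounded by \<open>f\<^sup>-\<^sup>1(y)\<close>. Let \<open>\<Lambda>\<close> be the projection along \<open>v\<close>.
  At a point of \<open>f\<^sup>-\<^sup>1(y)\<close> the restriction of \<open>f\<close> to the minimal simplex \<open>\<sigma>\<close> through the point is a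
  submersion, and at the other points of \<open>W\<close> the restriction of \<open>\<Lambda> \<circ> f\<close> to \<open>\<sigma>\<close> is one.

  If a simplexwise affine map \<open>F\<close> is a submersion on \<open>\<sigma>\<close>, then \<open>F\<close> is linear in a suitable PL chart, so
  that its fibres are PL manifolds. Indeed, near a point of \<open>\<sigma>\<close> that is generic for its affine pieces,
  any PL chart is equivariant under the translations along \<open>\<sigma>\<close>, and so is \<open>F\<close>. This replaces
  the usual argument through links, and in particular the fact that a suspension point of a PL sphere
  has a PL sphere as its link. That \<open>W\<close> has no further boundary points is invariance of domain.
\<close>

section \<open>PL maps near a point\<close>

text \<open>A chart at a point need not respect translations along \<sigma> there: one of its affine
  pieces may contain the point without containing a neighbourhood of it in \<sigma>. At a generic
  nearby point of \<sigma> every piece through the point contains a small ball of \<sigma>, and near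
  that point the polyhedron is a translate of what it is near the original one. This makes a chart
  at the generic point serve at the original point. The hypothesis on \<open>cov\<close> enters
  through Caratheodory: if \<open>y\<close> lies in the hull of the labels of a minimal simplex,
  then it lies in the hull of an independent subset of them, which must span the whole space
  affinely. On the open ray, genericity of \<open>v\<close> gives the same conclusion modulo
  \<open>v\<close>. At points of the fibre it would not suffice that
  \<open>\<Lambda> \<circ> f\<close> is a submersion: since \<open>f\<close> itself is linear in a
  chart, the ray pulls back to a half-space there, so these points are boundary points of
  \<open>W\<close>. As \<open>W\<close> is a subset of \<open>M\<close>, no larger ambient space is
  needed.\<close>

definition affine_map_on :: "'a::euclidean_space set \<Rightarrow> ('a \<Rightarrow> 'b::euclidean_space) \<Rightarrow> bool"
  where "affine_map_on C f \<longleftrightarrow> (\<exists>A b. linear A \<and> (\<forall>z\<in>C. f z = A z + b))"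

text \<open>The local half of \<open>pl_on\<close>, separated from continuity, with a ball in place
  of a relatively open set, so that several such conditions combine by taking the least
  radius.\<close>

definition pl_at :: "'a::euclidean_space set \<Rightarrow> ('a \<Rightarrow> 'b::euclidean_space) \<Rightarrow> 'a \<Rightarrow> bool"
  where "pl_at X f x \<longleftrightarrow>
    (\<exists>\<C> e. finite \<C> \<and> (\<forall>C\<in>\<C>. polytope C \<and> C \<subseteq> X \<and> affine_map_on C f) \<and>
       0 < e \<and> X \<inter> ball x e \<subseteq> \<Union>\<C>)"

lemma pl_atE:
  assumes "pl_at X f x"
  obtains \<C> e where "finite \<C>" "\<forall>C\<in>\<C>. polytope C" "\<forall>C\<in>\<C>. C \<subseteq> X"
    "\<forall>C\<in>\<C>. affine_map_on C f" "0 < e" "X \<inter> ball x e \<subseteq> \<Union>\<C>"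
  using assms unfolding pl_at_def by metis

lemma pl_on_iff: "pl_on X f \<longleftrightarrow> continuous_on X f \<and> (\<forall>x\<in>X. pl_at X f x)"
proof -
  have "(\<exists>\<C> U. finite \<C> \<and>
       (\<forall>C\<in>\<C>. polytope C \<and> C \<subseteq> X \<and> (\<exists>A b. linear A \<and> (\<forall>z\<in>C. f z = A z + b))) \<and>
       openin (top_of_set X) U \<and> x \<in> U \<and> U \<subseteq> \<Union>\<C>) \<longleftrightarrow> pl_at X f x" (is "?L \<longleftrightarrow> _")
    if "x \<in> X" for x
  proof
    assume ?L
    then obtain \<C> U where *: "finite \<C>" "\<forall>C\<in>\<C>. polytope C \<and> C \<subseteq> X \<and> affine_map_on C f"
      and U: "openin (top_of_set X) U" "x \<in> U" "U \<subseteq> \<Union>\<C>"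
      unfolding affine_map_on_def by blast
    obtain e where "0 < e" "ball x e \<inter> X \<subseteq> U"
      using U(1,2) unfolding openin_contains_ball by blast
    with * U(3) show "pl_at X f x"
      unfolding pl_at_def by (intro exI[of _ \<C>] exI[of _ e]) blast
  next
    assume "pl_at X f x"
    then obtain \<C> e where *: "finite \<C>" "\<forall>C\<in>\<C>. polytope C \<and> C \<subseteq> X \<and> affine_map_on C f"
      and e: "0 < e" "X \<inter> ball x e \<subseteq> \<Union>\<C>"
      unfolding pl_at_def by blast
    have "openin (top_of_set X) (X \<inter> ball x e)"
      by (simp add: openin_open_Int)
    with * e that show ?L
      unfolding affine_map_on_def[symmetric] by (intro exI[of _ \<C>] exI[of _ "X \<inter> ball x e"]) simp
  qed
  then show ?thesis unfolding pl_on_def by blast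
qed

section \<open>Polytopes under affine maps\<close>

lemma polyhedron_affine_vimage:
  fixes A :: "'a::euclidean_space \<Rightarrow> 'b::euclidean_space"
  assumes "polyhedron S" "linear A"
  shows "polyhedron {z. A z + b \<in> S}"
proof -
  obtain F where F: "finite F" "S = \<Inter>F" "\<forall>h\<in>F. \<exists>a b. a \<noteq> 0 \<and> h = {x. a \<bullet> x \<le> b}"
    using assms(1) unfolding polyhedron_def by blast
  have eq: "{z. A z + b \<in> S} = \<Inter>((\<lambda>h. {z. A z + b \<in> h}) ` F)"
    unfolding F(2) by auto
  have "polyhedron {z. A z + b \<in> h}" if hF: "h \<in> F" for h
  proof -
    obtain a c where h: "h = {x. a \<bullet> x \<le> c}" using F(3) hF by blast
    have "{z. A z + b \<in> h} = {z. adjoint A a \<bullet> z \<le> c - a \<bullet> b}"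
    proof -
      have "adjoint A a \<bullet> z = a \<bullet> A z" for z by (rule adjoint_clauses(2)[OF assms(2)])
      then show ?thesis unfolding h by (simp only: inner_add_right mem_Collect_eq le_diff_eq)
    qed
    \<comment> \<open>The normal \<open>adjoint A a\<close> may be zero; the preimage is then empty
      or the whole space, which \<open>polyhedron_halfspace_le\<close> covers.\<close>
    then show ?thesis by (simp add: polyhedron_halfspace_le)
  qed
  then show ?thesis unfolding eq using F(1) by (intro polyhedron_Inter) auto
qed

lemma polytope_affine_vimage:
  assumes "polytope C" "affine_map_on C f" "polyhedron D"
  shows "polytope {z\<in>C. f z \<in> D}"
proof -
  obtain A b where A: "linear A" "\<forall>z\<in>C. f z = A z + b"
    using assms(2) unfolding affine_map_on_def by blast
  have "{z\<in>C. f z \<in> D} = C \<inter> {z. A z + b \<in> D}" using A(2) by auto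
  then show ?thesis
    using polytope_Int_polyhedron[OF assms(1) polyhedron_affine_vimage[OF assms(3) A(1)]] by simp
qed

lemma polytope_affine_image:
  assumes "polytope C" "affine_map_on C f"
  shows "polytope (f ` C)"
proof -
  obtain A b where A: "linear A" "\<forall>z\<in>C. f z = A z + b"
    using assms(2) unfolding affine_map_on_def by blast
  have "f ` C = (+) b ` A ` C" using A(2) by (auto simp: image_image add.commute)
  then show ?thesis
    using polytope_linear_image[OF A(1) assms(1)] by (simp add: polytope_translation_eq)
qed

lemma affine_map_on_subset: "affine_map_on C f \<Longrightarrow> D \<subseteq> C \<Longrightarrow> affine_map_on D f"
  unfolding affine_map_on_def by blast

lemma affine_map_on_compose:
  assumes "affine_map_on C f" "affine_map_on D g" "f ` C \<subseteq> D"
  shows "affine_map_on C (\<lambda>z. g (f z))"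
proof -
  obtain A b where A: "linear A" "\<forall>z\<in>C. f z = A z + b"
    using assms(1) unfolding affine_map_on_def by blast
  obtain A' b' where A': "linear A'" "\<forall>z\<in>D. g z = A' z + b'"
    using assms(2) unfolding affine_map_on_def by blast
  have "\<forall>z\<in>C. g (f z) = (A' \<circ> A) z + (A' b + b')"
    using A(2) A'(2) assms(3) linear_add[OF A'(1)] by (auto simp: image_subset_iff)
  then show ?thesis
    unfolding affine_map_on_def using linear_compose[OF A(1) A'(1)] by blast
qed

lemma affine_map_on_linear: "linear A \<Longrightarrow> affine_map_on C (\<lambda>z. A z + b)"
  unfolding affine_map_on_def by blast

lemma affine_map_on_combination:
  assumes "affine_map_on C f" "affine_map_on C g" "linear P" "linear Q"
  shows "affine_map_on C (\<lambda>z. P (f z) + Q (g z) + c)"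
proof -
  obtain A b where A: "linear A" "\<forall>z\<in>C. f z = A z + b"
    using assms(1) unfolding affine_map_on_def by blast
  obtain A' b' where A': "linear A'" "\<forall>z\<in>C. g z = A' z + b'"
    using assms(2) unfolding affine_map_on_def by blast
  have "\<forall>z\<in>C. P (f z) + Q (g z) + c = (P (A z) + Q (A' z)) + (P b + Q b' + c)"
    using A(2) A'(2) linear_add[OF assms(3)] linear_add[OF assms(4)] by auto
  moreover have "linear (\<lambda>z. P (A z) + Q (A' z))"
    using linear_compose_add[OF linear_compose[OF A(1) assms(3)] linear_compose[OF A'(1) assms(4)]]
    by (simp add: o_def)
  ultimately show ?thesis
    unfolding affine_map_on_def by blast
qed

text \<open>The linear part \<open>A\<close> of \<open>f\<close> is injective at least in the
  directions of \<open>C\<close>, so it is inverted on the span \<open>E\<close> of the differences.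
  Convexity makes every element of \<open>E\<close> a positive multiple of a single difference of
  points of \<open>C\<close>; thus injectivity of \<open>f\<close> on \<open>C\<close> passes to
  \<open>A\<close> on \<open>E\<close>.\<close>

lemma affine_map_on_inverse:
  assumes f: "affine_map_on C f" and C: "convex C" and gf: "\<And>x. x \<in> C \<Longrightarrow> g (f x) = x"
  shows "affine_map_on (f ` C) g"
proof (cases "C = {}")
  case True
  then show ?thesis unfolding affine_map_on_def using linear_zero by auto
next
  case False
  then obtain c where c: "c \<in> C" by blast
  obtain A b where A: "linear A" "\<forall>z\<in>C. f z = A z + b"
    using f unfolding affine_map_on_def by blast
  define E where "E = span ((\<lambda>x. x - c) ` C)"
  have inj: "inj_on A E"
  proof (rule inj_onI)
    fix v w assume vw: "v \<in> E" "w \<in> E" "A v = A w"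
    have E1: "\<exists>t x y. 0 < t \<and> x \<in> C \<and> y \<in> C \<and> v = t *\<^sub>R (x - y)" if "v \<in> E" for v
    proof -
      define K where "K = {t *\<^sub>R (x - y) |t x y. 0 < t \<and> x \<in> C \<and> y \<in> C}"
      have KI: "t *\<^sub>R (x - y) \<in> K" if "0 < t" "x \<in> C" "y \<in> C" for t x y
        unfolding K_def using that by blast
      have K0: "0 \<in> K" using KI[of 1 c c] c by simp
      have "subspace K"
        unfolding subspace_def
      proof (intro conjI ballI allI)
        show "0 \<in> K" by (rule K0)
        fix k l assume "k \<in> K" "l \<in> K"
        then obtain t x y s x' y' where *: "k = t *\<^sub>R (x - y)" "l = s *\<^sub>R (x' - y')" "0 < t" "0 < s"
          "x \<in> C" "y \<in> C" "x' \<in> C" "y' \<in> C" unfolding K_def by blast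
        \<comment> \<open>With weights \<open>t / (t + s)\<close> and \<open>s / (t + s)\<close> the
          sum becomes one multiple of the difference of two convex combinations.\<close>
        have "k + l = (t + s) *\<^sub>R (((t / (t + s)) *\<^sub>R x + (s / (t + s)) *\<^sub>R x') - 
            ((t / (t + s)) *\<^sub>R y + (s / (t + s)) *\<^sub>R y'))"
          using * by (simp add: scaleR_right_diff_distrib scaleR_add_right)
        moreover have "(t / (t + s)) *\<^sub>R x + (s / (t + s)) *\<^sub>R x' \<in> C"
          "(t / (t + s)) *\<^sub>R y + (s / (t + s)) *\<^sub>R y' \<in> C"
          using * by (auto intro!: convexD[OF C] simp: add_divide_distrib[symmetric])
        ultimately show "k + l \<in> K" using KI[of "t + s"] * by simp
      next
        fix r :: real and k assume "k \<in> K"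
        then obtain t x y where *: "k = t *\<^sub>R (x - y)" "0 < t" "x \<in> C" "y \<in> C" 
          unfolding K_def by blast
        consider "0 < r" | "r = 0" | "r < 0" by linarith
        then show "r *\<^sub>R k \<in> K"
        proof cases
          case 1
          have "r *\<^sub>R k = (r * t) *\<^sub>R (x - y)" unfolding *(1) by simp
          then show ?thesis using KI[of "r * t" x y] *(2-4) 1 by simp
        next
          case 2
          then show ?thesis using K0 by simp
        next
          case 3
          have "r *\<^sub>R k = ((- r) * t) *\<^sub>R (y - x)" unfolding *(1) by (simp add: algebra_simps)
          moreover have "0 < (-r) * t" using 3 * by (simp add: mult_neg_pos)
          ultimately show ?thesis using KI[of "(-r) * t" y x] * by simp
        qed
      qed
      moreover have "(\<lambda>x. x - c) ` C \<subseteq> K"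
        using KI[of 1 _ c] c by auto
      ultimately have "E \<subseteq> K" unfolding E_def by (rule span_minimal[rotated])
      then show ?thesis using that unfolding K_def by blast
    qed
    have "v - w \<in> E" using vw unfolding E_def by (simp add: span_diff)
    from E1[OF this] obtain t x y where *: "0 < t" "x \<in> C" "y \<in> C" "v - w = t *\<^sub>R (x - y)"
      by blast
    have "t *\<^sub>R (A x - A y) = 0"
      using vw(3) *(4) by (metis A(1) linear_diff linear_scale right_minus_eq)
    then have "f x = f y" using *(1,2,3) A(2) by simp
    then have "x = y" using gf *(2,3) by metis
    then show "v = w" using *(4) by simp
  qed
  obtain A' where A': "linear A'" "\<forall>v\<in>E. A' (A v) = v"
    using linear_exists_left_inverse_on[OF A(1) _ inj] unfolding E_def by auto
  have "\<forall>w\<in>f ` C. g w = A' w + (c - A' (f c))"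
  proof
    fix w assume "w \<in> f ` C"
    then obtain x where x: "x \<in> C" "w = f x" by blast
    have "x - c \<in> E" unfolding E_def by (rule span_base) (use x in auto)
    then have "A' (A x - A c) = x - c" using A'(2) linear_diff[OF A(1)] by metis
    moreover have "A x - A c = f x - f c" using A(2) x c by auto
    ultimately have "A' (f x) - A' (f c) = x - c" by (simp add: linear_diff[OF A'(1)])
    then show "g w = A' w + (c - A' (f c))" using gf[OF x(1)] x(2) by (simp add: algebra_simps)
  qed
  then show ?thesis unfolding affine_map_on_def using A'(1) by blast
qed

text \<open>The pieces are the intersections of a piece of \<open>f\<close> with the preimage of a
  piece of \<open>g\<close>. Instead of assuming that \<open>f\<close> maps \<open>X\<close> into
  \<open>Y\<close>, the domain is cut down; with the identity for \<open>g\<close> this yields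
  restrictions of \<open>f\<close> to preimages.\<close>

lemma pl_at_compose:
  assumes f: "pl_at X f x" "continuous_on X f" "x \<in> X" and g: "pl_at Y g (f x)"
  shows "pl_at {z\<in>X. f z \<in> Y} (\<lambda>z. g (f z)) x"
proof -
  obtain \<C> e where C0: "finite \<C>" "\<forall>C\<in>\<C>. polytope C" "\<forall>C\<in>\<C>. C \<subseteq> X"
    "\<forall>C\<in>\<C>. affine_map_on C f" "0 < e" "X \<inter> ball x e \<subseteq> \<Union>\<C>"
    by (rule pl_atE[OF f(1)])
  note C = C0(1) bspec[OF C0(2)] bspec[OF C0(3)] bspec[OF C0(4)] C0(5,6)
  obtain \<D> e' where D0: "finite \<D>" "\<forall>C\<in>\<D>. polytope C" "\<forall>C\<in>\<D>. C \<subseteq> Y"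
    "\<forall>C\<in>\<D>. affine_map_on C g" "0 < e'" "Y \<inter> ball (f x) e' \<subseteq> \<Union>\<D>"
    by (rule pl_atE[OF g])
  note D = D0(1) bspec[OF D0(2)] bspec[OF D0(3)] bspec[OF D0(4)] D0(5,6)
  obtain d where d: "0 < d" "\<And>z. z \<in> X \<Longrightarrow> dist z x < d \<Longrightarrow> dist (f z) (f x) < e'"
    using f(2,3) D(5) unfolding continuous_on_iff by metis
  let ?\<E> = "(\<lambda>(C, D). {z\<in>C. f z \<in> D}) ` (\<C> \<times> \<D>)"
  show ?thesis
    unfolding pl_at_def
  proof (intro exI[of _ ?\<E>] exI[of _ "min e d"] conjI)
    show "finite ?\<E>" using C(1) D(1) by simp
    show "\<forall>E\<in>?\<E>. polytope E \<and> E \<subseteq> {z \<in> X. f z \<in> Y} \<and> affine_map_on E (\<lambda>z. g (f z))"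
    proof
      fix E assume "E \<in> ?\<E>"
      then obtain K D where E: "E = {z\<in>K. f z \<in> D}" "K \<in> \<C>" "D \<in> \<D>" by auto
      have "affine_map_on E f" "f ` E \<subseteq> D"
        using affine_map_on_subset[OF C(4)[OF E(2)]] E(1) by auto
      then have "affine_map_on E (\<lambda>z. g (f z))" using D(4)[OF E(3)] affine_map_on_compose by blast
      moreover have "polytope E"
        unfolding E(1) using C(2,4) D(2) E by (intro polytope_affine_vimage polytope_imp_polyhedron)
      moreover have "E \<subseteq> {z \<in> X. f z \<in> Y}" using E C(3) D(3) by blast
      ultimately show "polytope E \<and> E \<subseteq> {z \<in> X. f z \<in> Y} \<and> affine_map_on E (\<lambda>z. g (f z))" by blast
    qed
    show "0 < min e d" using C(5) d(1) by simp
    show "{z \<in> X. f z \<in> Y} \<inter> ball x (min e d) \<subseteq> \<Union> ?\<E>"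
    proof
      fix z assume z: "z \<in> {z \<in> X. f z \<in> Y} \<inter> ball x (min e d)"
      then have "z \<in> \<Union>\<C>" using C(6) by auto
      moreover have "dist (f z) (f x) < e'" using d(2)[of z] z dist_commute[of x z] by auto
      then have "f z \<in> \<Union>\<D>" using D(6) z by (auto simp: dist_commute)
      ultimately show "z \<in> \<Union> ?\<E>" by auto
    qed
  qed
qed

text \<open>Balls are not polytopes; a box between two balls serves to truncate pieces near a
  point.\<close>

lemma cbox_nbhd:
  fixes x :: "'a::euclidean_space"
  assumes "0 < e"
  obtains a b d where "0 < d" "ball x d \<subseteq> cbox a b" "cbox a b \<subseteq> ball x e"
proof -
  obtain a b where ab: "x \<in> box a b" "cbox a b \<subseteq> ball x e"
    using open_contains_cbox[of "ball x e" x] assms by (metis centre_in_ball open_ball)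
  obtain d where "0 < d" "ball x d \<subseteq> box a b"
    using ab(1) open_box open_contains_ball by blast
  then show thesis using that ab box_subset_cbox by blast
qed

text \<open>The sets \<open>Y\<close> and \<open>X \<inter> P\<close> need to agree near
  \<open>x\<close> alone. Since pieces must lie in \<open>Y\<close> entirely, they are cut with
  \<open>P\<close> and with a box inside the ball where the sets agree.\<close>

lemma pl_at_restrict:
  assumes "pl_at X f x" "polyhedron P" "0 < e" "Y \<inter> ball x e = X \<inter> P \<inter> ball x e"
  shows "pl_at Y f x"
proof -
  obtain \<C> e' where C0: "finite \<C>" "\<forall>C\<in>\<C>. polytope C" "\<forall>C\<in>\<C>. C \<subseteq> X"
    "\<forall>C\<in>\<C>. affine_map_on C f" "0 < e'" "X \<inter> ball x e' \<subseteq> \<Union>\<C>"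
    by (rule pl_atE[OF assms(1)])
  note C = C0(1) bspec[OF C0(2)] bspec[OF C0(3)] bspec[OF C0(4)] C0(5,6)
  obtain a b d where ab: "0 < d" "ball x d \<subseteq> cbox a b" "cbox a b \<subseteq> ball x e"
    using cbox_nbhd[OF assms(3)] .
  let ?\<E> = "(\<lambda>C. C \<inter> (P \<inter> cbox a b)) ` \<C>"
  show ?thesis
    unfolding pl_at_def
  proof (intro exI[of _ ?\<E>] exI[of _ "min d e'"] conjI)
    show "finite ?\<E>" using C(1) by simp
    show "\<forall>E\<in>?\<E>. polytope E \<and> E \<subseteq> Y \<and> affine_map_on E f"
    proof
      fix E assume "E \<in> ?\<E>"
      then obtain K where E: "E = K \<inter> (P \<inter> cbox a b)" "K \<in> \<C>" by auto
      have "polytope E"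
        unfolding E(1) using C(2)[OF E(2)] assms(2)
        by (intro polytope_Int_polyhedron polyhedron_Int) (auto intro: polytope_imp_polyhedron polytope_interval)
      moreover have "E \<subseteq> Y \<inter> ball x e" unfolding assms(4) using E C(3) ab(3) by blast
      moreover have "affine_map_on E f" using C(4)[OF E(2)] affine_map_on_subset E(1) by blast
      ultimately show "polytope E \<and> E \<subseteq> Y \<and> affine_map_on E f" by blast
    qed
    show "0 < min d e'" using ab C by simp
    show "Y \<inter> ball x (min d e') \<subseteq> \<Union> ?\<E>"
    proof
      fix z assume z: "z \<in> Y \<inter> ball x (min d e')"
      then have "z \<in> cbox a b" using ab by auto
      moreover from this have "z \<in> X \<inter> P" using assms(4) z ab by blast
      ultimately show "z \<in> \<Union> ?\<E>" using C(6) z by auto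
    qed
  qed
qed

lemma pl_at_subset_open:
  assumes "pl_at X f x" "openin (top_of_set X) N" "x \<in> N"
  shows "pl_at N f x"
proof -
  obtain e where "0 < e" "ball x e \<inter> X \<subseteq> N"
    using assms(2,3) unfolding openin_contains_ball by blast
  moreover have "N \<subseteq> X" using assms(2) openin_imp_subset by blast
  ultimately show ?thesis
    by (intro pl_at_restrict[OF assms(1) polyhedron_UNIV, of e]) auto
qed

lemma pl_at_affine:
  assumes "pl_at X f x" "linear A"
  shows "pl_at X (\<lambda>z. A z + b) x"
  using assms affine_map_on_linear[OF assms(2)] unfolding pl_at_def by metis

lemma pl_at_combination:
  assumes "pl_at X f x" "pl_at X g x" "linear P" "linear Q"
  shows "pl_at X (\<lambda>z. P (f z) + Q (g z) + c) x"
proof -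
  obtain \<C> e where C0: "finite \<C>" "\<forall>C\<in>\<C>. polytope C" "\<forall>C\<in>\<C>. C \<subseteq> X"
    "\<forall>C\<in>\<C>. affine_map_on C f" "0 < e" "X \<inter> ball x e \<subseteq> \<Union>\<C>"
    by (rule pl_atE[OF assms(1)])
  note C = C0(1) bspec[OF C0(2)] bspec[OF C0(3)] bspec[OF C0(4)] C0(5,6)
  obtain \<D> e' where D0: "finite \<D>" "\<forall>C\<in>\<D>. polytope C" "\<forall>C\<in>\<D>. C \<subseteq> X"
    "\<forall>C\<in>\<D>. affine_map_on C g" "0 < e'" "X \<inter> ball x e' \<subseteq> \<Union>\<D>"
    by (rule pl_atE[OF assms(2)])
  note D = D0(1) bspec[OF D0(2)] bspec[OF D0(3)] bspec[OF D0(4)] D0(5,6)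
  let ?\<E> = "(\<lambda>(C, D). C \<inter> D) ` (\<C> \<times> \<D>)"
  show ?thesis
    unfolding pl_at_def
  proof (intro exI[of _ ?\<E>] exI[of _ "min e e'"] conjI)
    show "finite ?\<E>" using C(1) D(1) by simp
    show "\<forall>E\<in>?\<E>. polytope E \<and> E \<subseteq> X \<and> affine_map_on E (\<lambda>z. P (f z) + Q (g z) + c)"
    proof
      fix E assume "E \<in> ?\<E>"
      then obtain K D where E: "E = K \<inter> D" "K \<in> \<C>" "D \<in> \<D>" by auto
      have "affine_map_on E f" "affine_map_on E g"
        using affine_map_on_subset C(4) D(4) E by blast+
      then show "polytope E \<and> E \<subseteq> X \<and> affine_map_on E (\<lambda>z. P (f z) + Q (g z) + c)"
        using E C(2,3) D(2) assms(3,4) by (auto intro: polytope_Int affine_map_on_combination)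
    qed
    show "0 < min e e'" using C(5) D(5) by simp
    show "X \<inter> ball x (min e e') \<subseteq> \<Union> ?\<E>" using C(6) D(6) by fastforce
  qed
qed

text \<open>The images of the pieces of \<open>f\<close> are pieces for \<open>g\<close> by
  \<open>affine_map_on_inverse\<close>, and continuity of \<open>g\<close> makes finitely many of
  them cover a neighbourhood. A PL homeomorphism therefore has to be checked in one
  direction.\<close>

lemma pl_on_inverse:
  assumes h: "homeomorphism X Y f g" and f: "pl_on X f"
  shows "pl_on Y g"
  unfolding pl_on_iff
proof (intro conjI ballI)
  show "continuous_on Y g" using h unfolding homeomorphism_def by blast
  fix y assume y: "y \<in> Y"
  then have gy: "g y \<in> X" using h unfolding homeomorphism_def by blast
  have fy: "pl_at X f (g y)" using f gy unfolding pl_on_iff by blast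
  obtain \<C> e where C0: "finite \<C>" "\<forall>C\<in>\<C>. polytope C" "\<forall>C\<in>\<C>. C \<subseteq> X"
    "\<forall>C\<in>\<C>. affine_map_on C f" "0 < e" "X \<inter> ball (g y) e \<subseteq> \<Union>\<C>"
    by (rule pl_atE[OF fy])
  note C = C0(1) bspec[OF C0(2)] bspec[OF C0(3)] bspec[OF C0(4)] C0(5,6)
  obtain d where d: "0 < d" "\<And>z. z \<in> Y \<Longrightarrow> dist z y < d \<Longrightarrow> dist (g z) (g y) < e"
    using \<open>continuous_on Y g\<close> y C(5) unfolding continuous_on_iff by metis
  show "pl_at Y g y"
    unfolding pl_at_def
  proof (intro exI[of _ "(`) f ` \<C>"] exI[of _ d] conjI ballI)
    show "finite ((`) f ` \<C>)" using C(1) by simp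
    show "0 < d" by (rule d)
    show "Y \<inter> ball y d \<subseteq> \<Union> ((`) f ` \<C>)"
    proof
      fix z assume z: "z \<in> Y \<inter> ball y d"
      then have "g z \<in> X" using homeomorphism_image2[OF h] by blast
      moreover have "dist (g y) (g z) < e" using d(2)[of z] z by (simp add: dist_commute)
      ultimately have "g z \<in> \<Union>\<C>" using C(6) by auto
      moreover have "f (g z) = z" using z homeomorphism_apply2[OF h] by blast
      ultimately show "z \<in> \<Union> ((`) f ` \<C>)" by force
    qed
    fix D assume "D \<in> (`) f ` \<C>"
    then obtain K where K: "D = f ` K" "K \<in> \<C>" by blast
    have gf: "\<And>x. x \<in> K \<Longrightarrow> g (f x) = x" using C(3)[OF K(2)] homeomorphism_apply1[OF h] by blast
    show "polytope D" unfolding K(1) using C(2,4) K(2) by (intro polytope_affine_image)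
    show "D \<subseteq> Y" unfolding K(1) using C(3)[OF K(2)] homeomorphism_image1[OF h] by blast
    show "affine_map_on D g"
      unfolding K(1)
      by (rule affine_map_on_inverse[OF C(4)[OF K(2)] polytope_imp_convex[OF C(2)[OF K(2)]] gf])
  qed
qed

lemma pl_homeomorphismI: "homeomorphism X Y f g \<Longrightarrow> pl_on X f \<Longrightarrow> pl_homeomorphism X Y f g"
  unfolding pl_homeomorphism_def using pl_on_inverse by blast

lemma pl_on_compose:
  assumes "pl_on X f" "pl_on Y g" "f ` X \<subseteq> Y"
  shows "pl_on X (\<lambda>z. g (f z))"
  unfolding pl_on_iff
proof (intro conjI ballI)
  show "continuous_on X (\<lambda>z. g (f z))"
    using assms unfolding pl_on_def by (metis continuous_on_compose2)
  fix x assume x: "x \<in> X"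
  have "{z \<in> X. f z \<in> Y} = X" using assms(3) by auto
  then show "pl_at X (\<lambda>z. g (f z)) x"
    using pl_at_compose[of X f x Y g] assms x unfolding pl_on_iff by auto
qed

lemma pl_homeomorphism_compose:
  assumes "pl_homeomorphism X Y f g" "pl_homeomorphism Y Z f' g'"
  shows "pl_homeomorphism X Z (\<lambda>x. f' (f x)) (\<lambda>z. g (g' z))"
proof (rule pl_homeomorphismI)
  show "homeomorphism X Z (\<lambda>x. f' (f x)) (\<lambda>z. g (g' z))"
    using homeomorphism_compose[of X Y f g Z f' g'] assms unfolding pl_homeomorphism_def o_def by blast
  have "f ` X \<subseteq> Y" using assms unfolding pl_homeomorphism_def homeomorphism_def by blast
  then show "pl_on X (\<lambda>x. f' (f x))"
    using assms pl_on_compose unfolding pl_homeomorphism_def by blast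
qed

lemma pl_homeomorphism_sym: "pl_homeomorphism X Y f g \<Longrightarrow> pl_homeomorphism Y X g f"
  unfolding pl_homeomorphism_def using homeomorphism_symD by blast

text \<open>That the identity is \<open>pl_at Y'\<close> says that \<open>Y'\<close> is a polyhedron
  near \<open>w\<close>. This is the condition under which the restriction of a PL map to the
  preimage of \<open>Y'\<close> still has its pieces inside the domain.\<close>

lemma pl_homeomorphism_vimage:
  assumes fg: "pl_homeomorphism X Y f g" and YY: "Y' \<subseteq> Y" and pl: "\<And>w. w \<in> Y' \<Longrightarrow> pl_at Y' (\<lambda>z. z) w"
  shows "pl_homeomorphism {x\<in>X. f x \<in> Y'} Y' f g"
proof (rule pl_homeomorphismI)
  have h: "homeomorphism X Y f g" using fg unfolding pl_homeomorphism_def by blast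
  show "homeomorphism {x\<in>X. f x \<in> Y'} Y' f g"
    by (rule homeomorphism_of_subsets[OF h]) (use YY h in \<open>auto simp: homeomorphism_def\<close>)
  have f: "pl_on X f" using fg unfolding pl_homeomorphism_def by blast
  show "pl_on {x\<in>X. f x \<in> Y'} f"
    unfolding pl_on_iff
  proof (intro conjI ballI)
    show "continuous_on {x\<in>X. f x \<in> Y'} f"
      using f unfolding pl_on_def by (auto elim: continuous_on_subset)
    fix x assume "x \<in> {x\<in>X. f x \<in> Y'}"
    then show "pl_at {x\<in>X. f x \<in> Y'} f x"
      using pl_at_compose[of X f x Y' "\<lambda>z. z"] f pl unfolding pl_on_iff by auto
  qed
qed

section \<open>Translations along a face\<close>

lemma finite_uniform_radius:
  fixes P :: "'i \<Rightarrow> real \<Rightarrow> bool"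
  assumes "finite I" "\<And>i. i \<in> I \<Longrightarrow> \<exists>e>0. P i e"
    and mono: "\<And>i e e'. P i e \<Longrightarrow> 0 < e' \<Longrightarrow> e' \<le> e \<Longrightarrow> P i e'"
  shows "\<exists>e>0. \<forall>i\<in>I. P i e"
  using assms(1,2)
proof (induction I)
  case empty
  then show ?case by (auto intro: exI[of _ 1])
next
  case (insert i I)
  obtain e where e: "0 < e" "\<forall>i\<in>I. P i e" using insert by auto
  obtain e' where e': "0 < e'" "P i e'" using insert by auto
  have "\<forall>j\<in>insert i I. P j (min e e')" using e e' mono by (auto intro: mono)
  then show ?case using e e' by (metis min_less_iff_conj)
qed

text \<open>Used to extend linear identities and inequalities from a ball of \<open>E\<close> to all
  of \<open>E\<close>.\<close>

lemma subspace_small_multiple: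
  fixes l :: "'a::real_normed_vector"
  assumes "subspace E" "l \<in> E" "0 < \<delta>"
  obtains t where "0 < t" "t *\<^sub>R l \<in> E" "norm (t *\<^sub>R l) < \<delta>"
proof
  let ?t = "\<delta> / (norm l + 1)"
  have n: "0 < norm l + 1" by (smt (verit) norm_ge_zero)
  show "0 < ?t" using assms(3) n by simp
  show "?t *\<^sub>R l \<in> E" using assms(1,2) by (rule subspace_scale)
  have "\<delta> * norm l < \<delta> * (norm l + 1)" using assms(3) by simp
  then show "norm (?t *\<^sub>R l) < \<delta>" using n assms(3) by (simp add: divide_simps abs_of_pos)
qed

text \<open>Constraints that are active at \<open>x\<close> vanish on \<open>E\<close>; the others are irrelevant near \<open>x\<close>.\<close>

lemma polyhedron_translation_invariant:
  fixes x :: "'a::euclidean_space"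
  assumes C: "polyhedron C" and E: "subspace E" and \<delta>: "0 < \<delta>" "\<forall>l\<in>E. norm l < \<delta> \<longrightarrow> x + l \<in> C"
  shows "\<exists>\<epsilon>>0. \<forall>u l. l \<in> E \<longrightarrow> norm u < \<epsilon> \<longrightarrow> norm (u + l) < \<epsilon> \<longrightarrow> x + u \<in> C \<longrightarrow> x + u + l \<in> C"
proof -
  obtain H where H: "finite H" "C = \<Inter>H" "\<forall>h\<in>H. \<exists>a b. a \<noteq> 0 \<and> h = {x. a \<bullet> x \<le> b}"
    using C unfolding polyhedron_def by blast
  have "\<exists>\<epsilon>>0. \<forall>h\<in>H. \<forall>u l. l \<in> E \<longrightarrow> norm (u + l) < \<epsilon> \<longrightarrow> x + u \<in> h \<longrightarrow> x + u + l \<in> h"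
  proof (rule finite_uniform_radius[OF H(1)])
    fix h assume h: "h \<in> H"
    then obtain a b where a: "a \<noteq> 0" and hab: "h = {x. a \<bullet> x \<le> b}" using H(3) by blast
    have le: "a \<bullet> (x + l) \<le> b" if "l \<in> E" "norm l < \<delta>" for l
      using \<delta>(2) that h hab H(2) by blast
    have x: "a \<bullet> x \<le> b" using le[of 0] \<delta> subspace_0[OF E] by simp
    show "\<exists>\<epsilon>>0. \<forall>u l. l \<in> E \<longrightarrow> norm (u + l) < \<epsilon> \<longrightarrow> x + u \<in> h \<longrightarrow> x + u + l \<in> h"
    proof (cases "a \<bullet> x = b")
      case True
      have z: "a \<bullet> l = 0" if l: "l \<in> E" for l
      proof -
        obtain t where t: "0 < t" "t *\<^sub>R l \<in> E" "norm (t *\<^sub>R l) < \<delta>"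
          using subspace_small_multiple[OF E l \<delta>(1)] .
        have "t * (a \<bullet> l) \<le> 0" using le[OF t(2,3)] True by (simp add: inner_add_right)
        moreover have "- (t * (a \<bullet> l)) \<le> 0"
          using le[of "- (t *\<^sub>R l)"] t subspace_neg[OF E t(2)] True by (simp add: inner_diff_right)
        ultimately show ?thesis using t(1) by (simp add: mult_le_0_iff zero_le_mult_iff)
      qed
      then show ?thesis unfolding hab by (auto simp: inner_add_right intro!: exI[of _ 1])
    next
      case False
      have na: "0 < norm a" using a by simp
      \<comment> \<open>The radius is the distance of \<open>x\<close> from the bounding
        hyperplane.\<close>
      have "a \<bullet> (x + u + l) \<le> b" if "norm (u + l) < (b - a \<bullet> x) / norm a" for u l
      proof -
        have "a \<bullet> (u + l) \<le> norm a * norm (u + l)" by (rule norm_cauchy_schwarz)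
        also have "\<dots> \<le> b - a \<bullet> x" using that na by (simp add: pos_less_divide_eq mult.commute)
        finally show ?thesis by (simp add: inner_add_right)
      qed
      moreover have "0 < (b - a \<bullet> x) / norm a" using x False na by simp
      ultimately show ?thesis unfolding hab by blast
    qed
  qed (meson less_le_trans)
  then obtain \<epsilon> where "\<epsilon> > 0"
    "\<forall>h\<in>H. \<forall>u l. l \<in> E \<longrightarrow> norm (u + l) < \<epsilon> \<longrightarrow> x + u \<in> h \<longrightarrow> x + u + l \<in> h" by blast
  then show ?thesis unfolding H(2) by (intro exI[of _ \<epsilon>]) blast
qed

text \<open>Near \<open>x\<close> there are only pieces through \<open>x\<close>, and each is
  invariant under small translations in \<open>E\<close>. All these pieces contain a common ball of
  \<open>x + E\<close>, on which \<open>f\<close> has one value, so their linear parts agree on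
  \<open>E\<close>. The displacement \<open>u\<close> is arbitrary; only \<open>l\<close> lies in
  \<open>E\<close>.\<close>

lemma piecewise_affine_translation:
  fixes f :: "'a::euclidean_space \<Rightarrow> 'b::euclidean_space"
  assumes fin: "finite \<C>" and C: "\<And>C. C \<in> \<C> \<Longrightarrow> polytope C" "\<And>C. C \<in> \<C> \<Longrightarrow> C \<subseteq> X"
      "\<And>C. C \<in> \<C> \<Longrightarrow> affine_map_on C f"
    and e: "0 < e" "X \<inter> ball x e \<subseteq> \<Union>\<C>" and x: "x \<in> X"
    and E: "subspace E" and \<delta>: "0 < \<delta>" "\<And>C l. C \<in> \<C> \<Longrightarrow> x \<in> C \<Longrightarrow> l \<in> E \<Longrightarrow> norm l < \<delta> \<Longrightarrow> x + l \<in> C"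
  shows "\<exists>\<epsilon> A. 0 < \<epsilon> \<and> linear A \<and> (\<forall>u l. l \<in> E \<longrightarrow> norm u < \<epsilon> \<longrightarrow> norm (u + l) < \<epsilon> \<longrightarrow> x + u \<in> X \<longrightarrow>
            x + u + l \<in> X \<and> f (x + u + l) = f (x + u) + A l)"
proof -
  let ?P = "\<lambda>C \<epsilon>. (x \<notin> C \<longrightarrow> C \<inter> ball x \<epsilon> = {}) \<and>
    (x \<in> C \<longrightarrow> (\<forall>u l. l \<in> E \<longrightarrow> norm u < \<epsilon> \<longrightarrow> norm (u + l) < \<epsilon> \<longrightarrow> x + u \<in> C \<longrightarrow> x + u + l \<in> C))"
  have "\<exists>\<epsilon>>0. \<forall>C\<in>\<C>. ?P C \<epsilon>"
  proof (rule finite_uniform_radius[OF fin])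
    fix K assume K: "K \<in> \<C>"
    show "\<exists>\<epsilon>>0. ?P K \<epsilon>"
    proof (cases "x \<in> K")
      case True
      then show ?thesis
        using polyhedron_translation_invariant[OF polytope_imp_polyhedron[OF C(1)[OF K]] E \<delta>(1), of x]
          \<delta>(2)[OF K] by auto
    next
      case False
      have "open (- K)" using polytope_imp_closed[OF C(1)[OF K]] by blast
      then obtain \<epsilon> where "0 < \<epsilon>" "ball x \<epsilon> \<subseteq> - K" using False open_contains_ball by blast
      then show ?thesis using False by blast
    qed
  next
    fix K and \<epsilon> \<epsilon>' :: real assume *: "?P K \<epsilon>" "0 < \<epsilon>'" "\<epsilon>' \<le> \<epsilon>"
    have "ball x \<epsilon>' \<subseteq> ball x \<epsilon>" using *(3) by (rule subset_ball)
    moreover have "norm v < \<epsilon>" if "norm v < \<epsilon>'" for v :: 'a using that *(3) by linarith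
    ultimately show "?P K \<epsilon>'" using *(1) by blast
  qed
  then obtain \<epsilon> where \<epsilon>: "0 < \<epsilon>" and P0: "\<forall>C\<in>\<C>. ?P C \<epsilon>" by (elim exE conjE) (rule that)
  note P = bspec[OF P0]
  obtain C0 where C0: "C0 \<in> \<C>" "x \<in> C0" using e x by auto
  obtain A b where A: "linear A" "\<forall>z\<in>C0. f z = A z + b"
    using C(3)[OF C0(1)] unfolding affine_map_on_def by blast
  have step: "x + u + l \<in> X \<and> f (x + u + l) = f (x + u) + A l"
    if l: "l \<in> E" and u: "norm u < min \<epsilon> e" "norm (u + l) < min \<epsilon> e" "x + u \<in> X" for u l
  proof -
    have "x + u \<in> ball x e" using u(1) by (simp add: dist_norm)
    then obtain K where K: "K \<in> \<C>" "x + u \<in> K" using e(2) u(3) by blast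
    have "x + u \<in> ball x \<epsilon>" using u(1) by (simp add: dist_norm)
    then have xK: "x \<in> K" using P[OF K(1)] K(2) by blast
    then have ul: "x + u + l \<in> K" using P[OF K(1)] K(2) l u by simp
    obtain A' b' where A': "linear A'" "\<forall>z\<in>K. f z = A' z + b'"
      using C(3)[OF K(1)] unfolding affine_map_on_def by blast
    \<comment> \<open>Comparing the values of \<open>f\<close> at \<open>x\<close> and at
      \<open>x + t *\<^sub>R l\<close>, which both lie in \<open>K\<close> and in the reference
      piece \<open>C0\<close>, identifies the two linear parts on \<open>l\<close>.\<close>
    obtain t where t: "0 < t" "t *\<^sub>R l \<in> E" "norm (t *\<^sub>R l) < \<delta>"
      using subspace_small_multiple[OF E l \<delta>(1)] .
    have "x + t *\<^sub>R l \<in> K" "x + t *\<^sub>R l \<in> C0" using \<delta>(2) t K C0 xK by blast+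
    then have "A' (x + t *\<^sub>R l) + b' = A (x + t *\<^sub>R l) + b" and x0: "A' x + b' = A x + b"
      using bspec[OF A(2)] bspec[OF A'(2)] xK C0(2) by force+
    then have e1: "A' x + A' (t *\<^sub>R l) + b' = A x + A (t *\<^sub>R l) + b"
      unfolding linear_add[OF A(1)] linear_add[OF A'(1)] by simp
    have "A' (t *\<^sub>R l) = (A' x + A' (t *\<^sub>R l) + b') - (A' x + b')" by simp
    also have "\<dots> = A (t *\<^sub>R l)" unfolding e1 x0 by simp
    finally have "A' (t *\<^sub>R l) = A (t *\<^sub>R l)" .
    then have "t *\<^sub>R A' l = t *\<^sub>R A l"
      unfolding linear_scale[OF A(1)] linear_scale[OF A'(1)] .
    then have eq: "A' l = A l" using t(1) by simp
    have "f (x + u + l) = f (x + u) + A' l"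
      using A'(2) ul K(2) by (simp add: linear_add[OF A'(1)])
    then show ?thesis using eq ul C(2)[OF K(1)] by auto
  qed
  show ?thesis
    using step A(1) \<epsilon> e(1) by (intro exI[of _ "min \<epsilon> e"] exI[of _ A]) auto
qed

text \<open>The closed sets are treated one after the other: a ball in \<open>x + E\<close> that is not contained in
  the next set contains a smaller ball that misses it.\<close>

lemma generic_point_of_closed_family:
  fixes x :: "'a::real_normed_vector"
  assumes fin: "finite \<C>" and cl: "\<And>C. C \<in> \<C> \<Longrightarrow> closed C" and E: "subspace E" and r: "0 < r"
  shows "\<exists>l\<^sub>1\<in>E. \<exists>\<delta>>0. norm l\<^sub>1 < r \<and>
    (\<forall>C\<in>\<C>. (\<forall>l\<in>E. norm l < \<delta> \<longrightarrow> x + l\<^sub>1 + l \<in> C) \<or> (\<forall>l\<in>E. norm l < \<delta> \<longrightarrow> x + l\<^sub>1 + l \<notin> C))"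
  using fin cl
proof (induction \<C>)
  case empty
  then show ?case using subspace_0[OF E] r by (auto intro!: bexI[of _ 0] exI[of _ 1])
next
  case (insert K \<C>)
  obtain l1 \<delta> where l1: "l1 \<in> E" "0 < \<delta>" "norm l1 < r"
    and d: "\<And>C. C \<in> \<C> \<Longrightarrow> (\<forall>l\<in>E. norm l < \<delta> \<longrightarrow> x + l1 + l \<in> C) \<or> (\<forall>l\<in>E. norm l < \<delta> \<longrightarrow> x + l1 + l \<notin> C)"
    using insert by (metis insertCI)
  \<comment> \<open>The bound \<open>r - norm l1\<close> leaves room for a further displacement by
    \<open>l\<close> with total norm below \<open>r\<close>.\<close>
  define \<eta> where "\<eta> = min \<delta> (r - norm l1)"
  have \<eta>: "0 < \<eta>" "\<eta> \<le> \<delta>" "\<eta> \<le> r - norm l1" unfolding \<eta>_def using l1 by auto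
  show ?case
  proof (cases "\<forall>l\<in>E. norm l < \<eta> \<longrightarrow> x + l1 + l \<in> K")
    case True
    have "(\<forall>l\<in>E. norm l < \<eta> \<longrightarrow> x + l1 + l \<in> C) \<or> (\<forall>l\<in>E. norm l < \<eta> \<longrightarrow> x + l1 + l \<notin> C)"
      if "C \<in> \<C>" for C
      using d[OF that] \<eta>(2) by (meson less_le_trans)
    then show ?thesis using True l1 \<eta> by (intro bexI[of _ l1] exI[of _ \<eta>]) auto
  next
    case False
    then obtain l where l: "l \<in> E" "norm l < \<eta>" "x + l1 + l \<notin> K" by blast
    have "open (- K)" using insert.prems by auto
    then obtain \<epsilon> where \<epsilon>: "0 < \<epsilon>" "ball (x + l1 + l) \<epsilon> \<subseteq> - K"
      using l(3) open_contains_ball by blast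
    define \<theta> where "\<theta> = min \<epsilon> (\<eta> - norm l)"
    have \<theta>: "0 < \<theta>" "\<theta> \<le> \<epsilon>" "\<theta> \<le> \<eta> - norm l" unfolding \<theta>_def using \<epsilon> l by auto
    have "x + (l1 + l) + k \<notin> K" if "norm k < \<theta>" for k
    proof -
      have "x + (l1 + l) + k \<in> ball (x + l1 + l) \<epsilon>"
        using that \<theta> by (simp add: dist_norm add.assoc)
      then show ?thesis using \<epsilon> by blast
    qed
    moreover have "(\<forall>k\<in>E. norm k < \<theta> \<longrightarrow> x + (l1 + l) + k \<in> C) \<or> (\<forall>k\<in>E. norm k < \<theta> \<longrightarrow> x + (l1 + l) + k \<notin> C)"
      if "C \<in> \<C>" for C
    proof -
      have "l + k \<in> E" "norm (l + k) < \<delta>" if "k \<in> E" "norm k < \<theta>" for k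
        using that l E \<theta> \<eta> norm_triangle_ineq[of l k] by (auto simp: subspace_add)
      then show ?thesis using d[OF that] by (metis add.assoc)
    qed
    moreover have "norm (l1 + l) < r" using l(2) \<eta>(3) norm_triangle_ineq[of l1 l] by simp
    moreover have "l1 + l \<in> E" using l l1 E by (simp add: subspace_add)
    ultimately show ?thesis using \<theta> by (intro bexI[of _ "l1 + l"] exI[of _ \<theta>]) auto
  qed
qed

section \<open>Straightening a simplexwise affine map in a PL chart\<close>

text \<open>A simplexwise affine map whose restriction to the minimal simplex through \<open>x\<^sub>0\<close> is a
  submersion becomes linear in a suitable PL chart. The given chart \<open>\<phi>\<close> is used near a nearby point
  \<open>x\<^sub>0 + l\<^sub>1\<close> of that simplex which is generic for the affine pieces of \<open>\<phi>\<close>, because \<open>\<phi>\<close> is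
  equivariant there under translations along the simplex.\<close>

lemma local_straightening:
  fixes F :: "'b::euclidean_space \<Rightarrow> 'c::euclidean_space" and \<phi> :: "'b \<Rightarrow> 'a::euclidean_space"
  assumes T: "finite \<T>" "\<And>\<tau>. \<tau> \<in> \<T> \<Longrightarrow> polytope \<tau>" "\<And>\<tau>. \<tau> \<in> \<T> \<Longrightarrow> affine_map_on \<tau> F" "\<Union>\<T> = X"
    and contF: "continuous_on X F" and x0: "x\<^sub>0 \<in> X" and E: "subspace E"
    and \<delta>: "0 < \<delta>" "\<And>\<tau> l. \<tau> \<in> \<T> \<Longrightarrow> x\<^sub>0 \<in> \<tau> \<Longrightarrow> l \<in> E \<Longrightarrow> norm l < \<delta> \<Longrightarrow> x\<^sub>0 + l \<in> \<tau>"
    and G: "linear G" "\<And>l. l \<in> E \<Longrightarrow> norm l < \<delta> \<Longrightarrow> F (x\<^sub>0 + l) = F x\<^sub>0 + G l"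
    and R: "G ` E = R" "\<And>x. x \<in> X \<Longrightarrow> F x - F x\<^sub>0 \<in> R"
    and chart: "openin (top_of_set X) N" "x\<^sub>0 \<in> N" "subspace V" "openin (top_of_set V) U"
      "pl_homeomorphism N U \<phi> \<phi>'"
  shows "\<exists>N' U' f g B. openin (top_of_set X) N' \<and> x\<^sub>0 \<in> N' \<and> openin (top_of_set V) U' \<and>
    pl_homeomorphism N' U' f g \<and> linear B \<and> B ` V = R \<and> (\<forall>x\<in>N'. F x = F x\<^sub>0 + B (f x))"
proof -
  have NX: "N \<subseteq> X" using chart(1) openin_imp_subset by blast
  have UV: "U \<subseteq> V" using chart(4) openin_imp_subset by blast
  have hom: "homeomorphism N U \<phi> \<phi>'" and pl\<phi>: "pl_on N \<phi>"
    using chart(5) unfolding pl_homeomorphism_def by blast+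
  have cont\<phi>: "continuous_on N \<phi>" using pl\<phi> unfolding pl_on_def by blast
  have \<phi>V: "\<phi> z \<in> V" if "z \<in> N" for z using that homeomorphism_image1[OF hom] UV by blast
  obtain e2 where e2: "0 < e2" "ball x\<^sub>0 e2 \<inter> X \<subseteq> N"
    using chart(1,2) unfolding openin_contains_ball by blast
  have plx0: "pl_at N \<phi> x\<^sub>0" using pl\<phi> chart(2) unfolding pl_on_iff by blast
  obtain \<C> e0 where C0: "finite \<C>" "\<forall>C\<in>\<C>. polytope C" "\<forall>C\<in>\<C>. C \<subseteq> N"
    "\<forall>C\<in>\<C>. affine_map_on C \<phi>" "0 < e0" "N \<inter> ball x\<^sub>0 e0 \<subseteq> \<Union>\<C>"
    by (rule pl_atE[OF plx0])
  have TX: "\<And>\<tau>. \<tau> \<in> \<T> \<Longrightarrow> \<tau> \<subseteq> X" using T(4) by blast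
  \<comment> \<open>The radius 1 is arbitrary, since \<open>\<T>\<close> covers all of
    \<open>X\<close>.\<close>
  have covX: "X \<inter> ball x\<^sub>0 1 \<subseteq> \<Union>\<T>" using T(4) by blast
  have "\<exists>\<epsilon> A. 0 < \<epsilon> \<and> linear A \<and> (\<forall>u l. l \<in> E \<longrightarrow> norm u < \<epsilon> \<longrightarrow> norm (u + l) < \<epsilon> \<longrightarrow> x\<^sub>0 + u \<in> X \<longrightarrow>
            x\<^sub>0 + u + l \<in> X \<and> F (x\<^sub>0 + u + l) = F (x\<^sub>0 + u) + A l)"
    by (rule piecewise_affine_translation[OF T(1) _ _ _ zero_less_one covX x0 E \<delta>(1)])
      (use T(2,3) TX \<delta>(2) in blast)+
  then obtain \<epsilon>1 A1 where \<epsilon>1: "0 < \<epsilon>1" and A1: "linear A1"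
    and tr: "\<And>u l. l \<in> E \<Longrightarrow> norm u < \<epsilon>1 \<Longrightarrow> norm (u + l) < \<epsilon>1 \<Longrightarrow> x\<^sub>0 + u \<in> X \<Longrightarrow>
            x\<^sub>0 + u + l \<in> X \<and> F (x\<^sub>0 + u + l) = F (x\<^sub>0 + u) + A1 l"
    by metis
  \<comment> \<open>The translation lemma yields some linear part; on \<open>E\<close> it is the
    prescribed derivative \<open>G\<close>, as both describe \<open>F\<close> on a ball of
    \<open>x\<^sub>0 + E\<close>.\<close>
  have A1G: "A1 l = G l" if l: "l \<in> E" for l
  proof -
    have "0 < min \<delta> \<epsilon>1" using \<delta>(1) \<epsilon>1 by simp
    then obtain t where t: "0 < t" "t *\<^sub>R l \<in> E" "norm (t *\<^sub>R l) < min \<delta> \<epsilon>1"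
      using subspace_small_multiple[OF E l] by metis
    have "A1 (t *\<^sub>R l) = G (t *\<^sub>R l)"
      using tr[of "t *\<^sub>R l" 0] G(2)[of "t *\<^sub>R l"] t x0 \<epsilon>1 by simp
    then show ?thesis using t(1) by (simp add: linear_scale[OF A1] linear_scale[OF G(1)])
  qed
  \<comment> \<open>Halved radii: the displacement \<open>l1\<close> followed by another one below
    the same half stays within the original radius.\<close>
  define r where "r = Min {\<epsilon>1 / 2, e0 / 2, e2 / 2}"
  have r: "0 < r" "r \<le> \<epsilon>1 / 2" "r \<le> e0 / 2" "r \<le> e2 / 2"
    unfolding r_def using \<epsilon>1 C0(5) e2(1) by auto

  \<comment> \<open>The generic base point and the equivariance of the chart there\<close>
  have "\<exists>l\<^sub>1\<in>E. \<exists>\<delta>>0. norm l\<^sub>1 < r \<and>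
    (\<forall>C\<in>\<C>. (\<forall>l\<in>E. norm l < \<delta> \<longrightarrow> x\<^sub>0 + l\<^sub>1 + l \<in> C) \<or> (\<forall>l\<in>E. norm l < \<delta> \<longrightarrow> x\<^sub>0 + l\<^sub>1 + l \<notin> C))"
    by (rule generic_point_of_closed_family[OF C0(1) _ E r(1)]) (use C0(2) polytope_imp_closed in blast)
  then obtain l1 \<delta>1 where l1: "l1 \<in> E" "0 < \<delta>1" "norm l1 < r" and
    gen: "\<And>C. C \<in> \<C> \<Longrightarrow> (\<forall>l\<in>E. norm l < \<delta>1 \<longrightarrow> x\<^sub>0 + l1 + l \<in> C) \<or> (\<forall>l\<in>E. norm l < \<delta>1 \<longrightarrow> x\<^sub>0 + l1 + l \<notin> C)"
    by metis
  define x1 where "x1 = x\<^sub>0 + l1"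
  have nearN: "x1 + u \<in> N" if "norm u < e2 / 2" "x1 + u \<in> X" for u
  proof -
    have "norm (l1 + u) < e2" using that(1) l1(3) r(4) norm_triangle_ineq[of l1 u] by linarith
    moreover have "dist (x1 + u) x\<^sub>0 = norm (l1 + u)" unfolding x1_def dist_norm by (simp add: algebra_simps)
    ultimately have "x1 + u \<in> ball x\<^sub>0 e2" by (simp add: dist_commute)
    then show ?thesis using that(2) e2(2) by blast
  qed
  \<comment> \<open>Translation by \<open>l1\<close> identifies the germ of \<open>X\<close> at
    \<open>x\<^sub>0\<close> with its germ at \<open>x1\<close>. This transports a chart at
    \<open>x1\<close> back to \<open>x\<^sub>0\<close>.\<close>
  have trX: "x\<^sub>0 + u \<in> X \<longleftrightarrow> x1 + u \<in> X" if u: "norm u < \<epsilon>1 / 2" for u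
  proof -
    have n: "norm (u + l1) < \<epsilon>1" "norm u < \<epsilon>1"
      using u l1(3) r(2) \<epsilon>1 norm_triangle_ineq[of u l1] by linarith+
    have n': "norm (u + l1 + - l1) < \<epsilon>1" using n(2) by simp
    have e: "x1 + u = x\<^sub>0 + u + l1" "x1 + u = x\<^sub>0 + (u + l1)" "x\<^sub>0 + u = x\<^sub>0 + (u + l1) + - l1"
      unfolding x1_def by simp_all
    show ?thesis
    proof
      assume "x\<^sub>0 + u \<in> X"
      from tr[OF l1(1) n(2,1) this] show "x1 + u \<in> X" unfolding e(1) by (rule conjunct1)
    next
      assume "x1 + u \<in> X"
      then have "x\<^sub>0 + (u + l1) \<in> X" unfolding e(2) .
      from tr[OF subspace_neg[OF E l1(1)] n(1) n' this] show "x\<^sub>0 + u \<in> X"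
        unfolding e(3) by (rule conjunct1)
    qed
  qed
  have x1X: "x1 \<in> X" using trX[of 0] x0 \<epsilon>1 by simp
  have x1N: "x1 \<in> N" using nearN[of 0] x1X e2(1) by simp
  have cov1: "N \<inter> ball x1 (e0 / 2) \<subseteq> \<Union>\<C>"
  proof -
    have "ball x1 (e0 / 2) \<subseteq> ball x\<^sub>0 e0"
    proof
      fix z assume "z \<in> ball x1 (e0 / 2)"
      moreover have "dist x\<^sub>0 x1 < e0 / 2" unfolding x1_def using l1(3) r(3) by (simp add: dist_norm)
      ultimately show "z \<in> ball x\<^sub>0 e0" using dist_triangle[of x\<^sub>0 z x1] by simp
    qed
    then show ?thesis using C0(6) by blast
  qed
  \<comment> \<open>For a piece through \<open>x1\<close> the displacement \<open>l = 0\<close>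
    excludes the second alternative of genericity.\<close>
  have gen1: "x1 + l \<in> C" if "C \<in> \<C>" "x1 \<in> C" "l \<in> E" "norm l < \<delta>1" for C l
    using gen[OF that(1)] that(2-) l1(2) subspace_0[OF E] unfolding x1_def by force
  have e0h: "0 < e0 / 2" using C0(5) by simp
  have "\<exists>\<epsilon> A. 0 < \<epsilon> \<and> linear A \<and> (\<forall>u l. l \<in> E \<longrightarrow> norm u < \<epsilon> \<longrightarrow> norm (u + l) < \<epsilon> \<longrightarrow> x1 + u \<in> N \<longrightarrow>
            x1 + u + l \<in> N \<and> \<phi> (x1 + u + l) = \<phi> (x1 + u) + A l)"
    by (rule piecewise_affine_translation[OF C0(1) _ _ _ e0h cov1 x1N E l1(2)])
      (use C0(2-4) gen1 in blast)+
  then obtain \<epsilon>2 A where \<epsilon>2: "0 < \<epsilon>2" and A: "linear A"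
    and tr\<phi>: "\<And>u l. l \<in> E \<Longrightarrow> norm u < \<epsilon>2 \<Longrightarrow> norm (u + l) < \<epsilon>2 \<Longrightarrow> x1 + u \<in> N \<Longrightarrow>
            x1 + u + l \<in> N \<and> \<phi> (x1 + u + l) = \<phi> (x1 + u) + A l"
    by metis
  define \<epsilon>3 where "\<epsilon>3 = Min {\<epsilon>2, \<epsilon>1 / 2, e2 / 2}"
  have \<epsilon>3: "0 < \<epsilon>3" "\<epsilon>3 \<le> \<epsilon>2" "\<epsilon>3 \<le> \<epsilon>1 / 2" "\<epsilon>3 \<le> e2 / 2"
    unfolding \<epsilon>3_def using \<epsilon>1 \<epsilon>2 e2(1) by auto
  have sh: "x1 + u \<in> N" if "norm u < \<epsilon>3" "x\<^sub>0 + u \<in> X" for u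
    using nearN[of u] trX[of u] that \<epsilon>3 by auto
  have A_mult: "\<exists>t. 0 < t \<and> x1 + t *\<^sub>R l \<in> N \<and> \<phi> (x1 + t *\<^sub>R l) = \<phi> x1 + t *\<^sub>R A l" if l: "l \<in> E" for l
  proof -
    obtain t where t: "0 < t" "t *\<^sub>R l \<in> E" "norm (t *\<^sub>R l) < \<epsilon>2"
      using subspace_small_multiple[OF E l \<epsilon>2] .
    then show ?thesis using tr\<phi>[of "t *\<^sub>R l" 0] x1N \<epsilon>2 by (auto simp: linear_scale[OF A])
  qed
  have AV: "A l \<in> V" if l: "l \<in> E" for l
  proof -
    obtain t where t: "0 < t" "x1 + t *\<^sub>R l \<in> N" "\<phi> (x1 + t *\<^sub>R l) = \<phi> x1 + t *\<^sub>R A l"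
      using A_mult[OF l] by blast
    have "\<phi> (x1 + t *\<^sub>R l) - \<phi> x1 \<in> V" using \<phi>V t(2) x1N chart(3) by (simp add: subspace_diff)
    then have "t *\<^sub>R A l \<in> V" using t(3) by simp
    then have "inverse t *\<^sub>R t *\<^sub>R A l \<in> V" using chart(3) subspace_scale by blast
    then show ?thesis using t(1) by simp
  qed
  \<comment> \<open>The derivative of the chart along \<open>E\<close> is injective because the
    chart is injective and moves affinely with speed \<open>A l\<close>.\<close>
  have A0: "l = 0" if l: "l \<in> E" "A l = 0" for l
  proof -
    obtain t where t: "0 < t" "x1 + t *\<^sub>R l \<in> N" "\<phi> (x1 + t *\<^sub>R l) = \<phi> x1 + t *\<^sub>R A l"
      using A_mult[OF l(1)] by blast
    then have "\<phi> (x1 + t *\<^sub>R l) = \<phi> x1" using l(2) by simp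
    then have "x1 + t *\<^sub>R l = x1" using homeomorphism_apply1[OF hom] t(2) x1N by metis
    then show ?thesis using t(1) by simp
  qed

  \<comment> \<open>The corrected chart\<close>
  have subR: "subspace R" using linear_subspace_image[OF G(1) E] R(1) by simp
  obtain s where s: "s ` UNIV \<subseteq> E" "linear s" "\<forall>v\<in>R. G (s v) = v"
    using linear_exists_right_inverse_on[OF G(1) E] R(1) by auto
  \<comment> \<open>For small \<open>v\<close> in \<open>R\<close>, translation by
    \<open>s v\<close> changes \<open>F\<close> by \<open>v\<close> and the shifted chart by
    \<open>\<Theta> v\<close>. So \<open>\<Theta>\<close> lifts changes of \<open>F\<close> to
    displacements in \<open>V\<close>, and its left inverse \<open>B\<close> will be the linear form
    of \<open>F\<close>.\<close>
  define \<Theta> where "\<Theta> = A \<circ> s"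
  have lin\<Theta>: "linear \<Theta>" unfolding \<Theta>_def by (rule linear_compose[OF s(2) A])
  have "inj_on \<Theta> R"
    unfolding linear_inj_on_iff_eq_0[OF lin\<Theta> subR]
  proof (intro ballI impI)
    fix v assume v: "v \<in> R" "\<Theta> v = 0"
    then have "s v = 0" using A0[of "s v"] s(1) unfolding \<Theta>_def by auto
    then show "v = 0" using s(3) v(1) linear_0[OF G(1)] by metis
  qed
  then obtain B where B: "B ` UNIV \<subseteq> R" "linear B" "\<forall>v\<in>R. B (\<Theta> v) = v"
    using linear_exists_left_inverse_on[OF lin\<Theta> subR] by blast
  have BV: "B ` V = R"
  proof
    show "B ` V \<subseteq> R" using B(1) by blast
    show "R \<subseteq> B ` V"
    proof
      fix v assume v: "v \<in> R"
      have "\<Theta> v \<in> V" unfolding \<Theta>_def using AV s(1) by auto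
      then show "v \<in> B ` V" using B(3) v by (metis image_eqI)
    qed
  qed
  obtain K where K: "0 < K" "\<And>z. norm (s (B z)) \<le> K * norm z"
    using linear_bounded_pos[OF linear_compose[OF B(2) s(2)]] by (auto simp: mult.commute)
  \<comment> \<open>Two chart values within this bound differ by less than
    \<open>\<epsilon>3 / (2 * K)\<close>, and \<open>s \<circ> B\<close> turns this into a
    displacement below \<open>\<epsilon>3 / 2\<close>. Added to a point displacement below
    \<open>\<epsilon>3 / 2\<close> it stays where equivariance holds.\<close>
  have "0 < \<epsilon>3 / (4 * K)" using \<epsilon>3(1) K(1) by simp
  then obtain d where d: "0 < d" "\<And>z. z \<in> N \<Longrightarrow> dist z x1 < d \<Longrightarrow> dist (\<phi> z) (\<phi> x1) < \<epsilon>3 / (4 * K)"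
    using cont\<phi> x1N unfolding continuous_on_iff by metis
  define \<epsilon> where "\<epsilon> = min d (\<epsilon>3 / 2)"
  have \<epsilon>: "0 < \<epsilon>" "\<epsilon> \<le> d" "\<epsilon> \<le> \<epsilon>3 / 2" "\<epsilon> < \<epsilon>3" unfolding \<epsilon>_def using d(1) \<epsilon>3(1) by auto
  define N' where "N' = X \<inter> ball x\<^sub>0 \<epsilon>"
  define \<psi> where "\<psi> x = \<phi> (x + l1) - \<phi> x1" for x
  define \<Psi> where "\<Psi> x = \<psi> x - \<Theta> (B (\<psi> x)) + \<Theta> (F x - F x\<^sub>0)" for x
  have N': "openin (top_of_set X) N'" "x\<^sub>0 \<in> N'" "N' \<subseteq> X"
    unfolding N'_def using x0 \<epsilon>(1) by (auto simp: openin_open_Int)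
  have N'N: "x + l1 \<in> N" if "x \<in> N'" for x
    using sh[of "x - x\<^sub>0"] that \<epsilon>(4) unfolding N'_def x1_def
    by (auto simp: dist_norm norm_minus_commute algebra_simps)
  have B\<Psi>: "B (\<Psi> x) = F x - F x\<^sub>0" if "x \<in> X" for x
  proof -
    have "B (\<Theta> (B (\<psi> x))) = B (\<psi> x)" "B (\<Theta> (F x - F x\<^sub>0)) = F x - F x\<^sub>0"
      using B(1,3) R(2)[OF that] by auto
    then show ?thesis unfolding \<Psi>_def by (simp add: linear_add[OF B(2)] linear_diff[OF B(2)])
  qed
  have \<Psi>V: "\<Psi> x \<in> V" if "x \<in> N'" for x
  proof -
    have "\<Theta> v \<in> V" for v unfolding \<Theta>_def using AV s(1) by auto
    moreover have "\<psi> x \<in> V" unfolding \<psi>_def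
      using \<phi>V[OF N'N[OF that]] \<phi>V[OF x1N] chart(3) by (simp add: subspace_diff)
    ultimately show ?thesis unfolding \<Psi>_def using chart(3) by (simp add: subspace_diff subspace_add)
  qed
  have inj: "inj_on \<Psi> N'"
  proof (rule inj_onI)
    fix x x' assume x: "x \<in> N'" "x' \<in> N'" "\<Psi> x = \<Psi> x'"
    have "x \<in> X" "x' \<in> X" using x(1,2) N'(3) by blast+
    then have "F x - F x\<^sub>0 = F x' - F x\<^sub>0" using B\<Psi> x(3) by metis
    then have FF: "F x = F x'" by simp
    have small: "norm (\<psi> z) < \<epsilon>3 / (4 * K)" if "z \<in> N'" for z
    proof -
      have "dist (z + l1) x1 < d"
        using that \<epsilon>(2) unfolding N'_def x1_def by (auto simp: dist_norm norm_minus_commute)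
      then show ?thesis using d(2)[OF N'N[OF that]] unfolding \<psi>_def by (simp add: dist_norm)
    qed
    define z where "z = \<psi> x - \<psi> x'"
    define l where "l = s (B z)"
    have lE: "l \<in> E" unfolding l_def using s(1) by auto
    have "norm z < \<epsilon>3 / (4 * K) + \<epsilon>3 / (4 * K)"
      unfolding z_def using norm_triangle_ineq4[of "\<psi> x" "\<psi> x'"] small[OF x(1)] small[OF x(2)] by linarith
    also have "\<dots> = \<epsilon>3 / (2 * K)" using K(1) by (simp add: field_simps)
    finally have "K * norm z < K * (\<epsilon>3 / (2 * K))" using K(1) by (rule mult_strict_left_mono)
    also have "\<dots> = \<epsilon>3 / 2" using K(1) by simp
    finally have nl: "norm l < \<epsilon>3 / 2" unfolding l_def using K(2)[of z] by linarith
    have zA: "z = A l"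
    proof -
      have "\<psi> x - \<Theta> (B (\<psi> x)) = \<psi> x' - \<Theta> (B (\<psi> x'))" using x(3) FF unfolding \<Psi>_def by simp
      then have "z = \<Theta> (B (\<psi> x)) - \<Theta> (B (\<psi> x'))" unfolding z_def by (simp add: algebra_simps)
      also have "\<dots> = \<Theta> (B z)" unfolding z_def by (simp add: linear_diff[OF lin\<Theta>] linear_diff[OF B(2)])
      finally show ?thesis unfolding l_def \<Theta>_def o_def .
    qed
    define u where "u = x' - x\<^sub>0"
    have nu: "norm u < \<epsilon>3 / 2" "norm u < \<epsilon>3" "x\<^sub>0 + u = x'" "x1 + u = x' + l1"
      using x(2) \<epsilon>(3,4) unfolding N'_def u_def x1_def by (auto simp: dist_norm norm_minus_commute)
    have nul: "norm (u + l) < \<epsilon>3" using norm_triangle_ineq[of u l] nu(1) nl by linarith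
    have t1: "x1 + u + l \<in> N \<and> \<phi> (x1 + u + l) = \<phi> (x1 + u) + A l"
      using tr\<phi>[OF lE, of u] nu nul \<epsilon>3(2) N'N[OF x(2)] by simp
    have t2: "F (x\<^sub>0 + u + l) = F (x\<^sub>0 + u) + G l"
      using tr[OF lE, of u] nu nul \<epsilon>3(3) \<epsilon>1 x(2) N'(3) A1G[OF lE] by auto
    have "\<phi> (x + l1) = \<phi> (x1 + u) + A l" unfolding zA[symmetric] z_def \<psi>_def nu(4) by simp
    then have "\<phi> (x + l1) = \<phi> (x1 + u + l)" using t1 by simp
    then have "x + l1 = x1 + u + l" using homeomorphism_apply1[OF hom] t1 N'N[OF x(1)] by metis
    then have xl: "x = x\<^sub>0 + u + l" unfolding x1_def by simp
    \<comment> \<open>This translation leaves \<open>F\<close> unchanged, while \<open>G\<close>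
      inverts \<open>s\<close> on \<open>R\<close>; hence \<open>B z = 0\<close> and the translation
      is trivial.\<close>
    then have "G l = 0" using t2 FF nu(3) by simp
    moreover have "G l = B z" unfolding l_def using s(3) B(1) by auto
    ultimately have "l = 0" unfolding l_def using linear_0[OF s(2)] by simp
    then show "x = x'" using xl nu(3) by simp
  qed
  define P where "P w = w - \<Theta> (B w)" for w
  have linP: "linear P"
    unfolding P_def using linear_compose_sub[OF linear_id linear_compose[OF B(2) lin\<Theta>]]
    by (simp add: o_def id_def)
  \<comment> \<open>Written as a combination of the shifted chart and \<open>F\<close> with linear
    coefficients, as \<open>pl_at_combination\<close> requires.\<close>
  have \<Psi>_eq: "\<Psi> = (\<lambda>x. P (\<phi> (x + l1)) + \<Theta> (F x) + (- P (\<phi> x1) - \<Theta> (F x\<^sub>0)))"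
    unfolding fun_eq_iff \<Psi>_def \<psi>_def P_def by (simp add: linear_diff[OF B(2)] linear_diff[OF lin\<Theta>])
  have cont_shift: "continuous_on N' (\<lambda>x. \<phi> (x + l1))"
    by (rule continuous_on_compose2[OF cont\<phi>]) (use N'N in \<open>auto intro!: continuous_intros\<close>)
  have contFN: "continuous_on N' F" using contF N'(3) by (rule continuous_on_subset)
  have cont\<Psi>: "continuous_on N' \<Psi>"
    unfolding \<Psi>_eq
    by (intro continuous_on_add continuous_on_const linear_continuous_on_compose[OF cont_shift linP]
        linear_continuous_on_compose[OF contFN lin\<Theta>])
  have "pl_on N' \<Psi>"
    unfolding pl_on_iff
  proof (intro conjI ballI cont\<Psi>)
    fix x assume x: "x \<in> N'"
    have "pl_at X F x"
      unfolding pl_at_def using T TX by (intro exI[of _ \<T>] exI[of _ 1]) auto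
    then have plF: "pl_at N' F x" using N'(1) x by (rule pl_at_subset_open)
    have cs: "continuous_on N' (\<lambda>z. z + l1)" by (intro continuous_intros)
    have "pl_at N' (\<lambda>z. id z + l1) x" using plF linear_id by (rule pl_at_affine)
    then have "pl_at {z \<in> N'. z + l1 \<in> N} (\<lambda>z. \<phi> (z + l1)) x"
      using pl_at_compose[of N' "\<lambda>z. z + l1" x N \<phi>] x pl\<phi> N'N[OF x] cs
      unfolding pl_on_iff by auto
    moreover have "{z \<in> N'. z + l1 \<in> N} = N'" using N'N by blast
    ultimately have "pl_at N' (\<lambda>z. \<phi> (z + l1)) x" by simp
    from pl_at_combination[OF this plF linP lin\<Theta>]
    show "pl_at N' \<Psi> x" unfolding \<Psi>_eq .
  qed
  \<comment> \<open>Invariance of domain concerns maps between open sets of linear spaces, so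
    \<open>\<Psi>\<close> is read in the shifted chart, as \<open>\<kappa>\<close> on an open subset
    of \<open>V\<close>.\<close>
  have open_im: "openin (top_of_set V) (\<Psi> ` S)" if S: "openin (top_of_set N') S" for S
  proof -
    have SN: "S \<subseteq> N'" using S openin_imp_subset by blast
    obtain O0 where O0: "open O0" "S = N' \<inter> O0" using S unfolding openin_open by blast
    define O1 where "O1 = (\<lambda>x. x + l1) ` (ball x\<^sub>0 \<epsilon> \<inter> O0)"
    have "open O1"
    proof -
      have "O1 = (+) l1 ` (ball x\<^sub>0 \<epsilon> \<inter> O0)" unfolding O1_def by (simp add: add.commute)
      moreover have "open (ball x\<^sub>0 \<epsilon> \<inter> O0)" using O0(1) by (simp add: open_Int)
      ultimately show ?thesis using open_translation by metis
    qed
    have eq: "(\<lambda>x. x + l1) ` S = N \<inter> O1"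
    proof
      show "(\<lambda>x. x + l1) ` S \<subseteq> N \<inter> O1"
        unfolding O0(2) O1_def using N'N by (auto simp: N'_def)
      show "N \<inter> O1 \<subseteq> (\<lambda>x. x + l1) ` S"
      proof
        fix z assume z: "z \<in> N \<inter> O1"
        then obtain x where x: "z = x + l1" "x \<in> ball x\<^sub>0 \<epsilon>" "x \<in> O0" unfolding O1_def by blast
        \<comment> \<open>Below this radius \<open>trX\<close> carries points of \<open>X\<close>
          near \<open>x1\<close> back to \<open>X\<close> near \<open>x\<^sub>0\<close>.\<close>
        have "norm (x - x\<^sub>0) < \<epsilon>1 / 2"
          using x(2) \<epsilon>(4) \<epsilon>3(3) by (simp add: dist_norm norm_minus_commute)
        moreover have "x1 + (x - x\<^sub>0) \<in> X" using z x(1) NX unfolding x1_def by (auto simp: algebra_simps)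
        ultimately have "x\<^sub>0 + (x - x\<^sub>0) \<in> X" using trX by blast
        then show "z \<in> (\<lambda>x. x + l1) ` S" unfolding O0(2) N'_def using x by auto
      qed
    qed
    have "openin (top_of_set N) ((\<lambda>x. x + l1) ` S)"
      unfolding eq using \<open>open O1\<close> by (rule openin_open_Int)
    then have opU: "openin (top_of_set U) (\<phi> ` (\<lambda>x. x + l1) ` S)"
      by (rule homeomorphism_imp_open_map[OF hom])
    then have op: "openin (top_of_set V) (\<phi> ` (\<lambda>x. x + l1) ` S)"
      using chart(4) openin_trans by blast
    define \<kappa> where "\<kappa> w = \<Psi> (\<phi>' w - l1)" for w
    have \<kappa>: "\<kappa> (\<phi> (x + l1)) = \<Psi> x" if "x \<in> S" for x
      unfolding \<kappa>_def using homeomorphism_apply1[OF hom N'N] that SN by auto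
    have im: "\<kappa> ` \<phi> ` (\<lambda>x. x + l1) ` S = \<Psi> ` S"
      using \<kappa> by (auto simp: image_image)
    have inv: "\<phi>' w - l1 \<in> N'" if "w \<in> \<phi> ` (\<lambda>x. x + l1) ` S" for w
      using that homeomorphism_apply1[OF hom N'N] SN by auto
    have "continuous_on (\<phi> ` (\<lambda>x. x + l1) ` S) \<phi>'"
      using homeomorphism_cont2[OF hom] openin_imp_subset[OF opU] by (rule continuous_on_subset)
    then have "continuous_on (\<phi> ` (\<lambda>x. x + l1) ` S) \<kappa>"
      unfolding \<kappa>_def by (intro continuous_on_compose2[OF cont\<Psi>] continuous_intros) (use inv in auto)
    moreover have "inj_on \<kappa> (\<phi> ` (\<lambda>x. x + l1) ` S)"
    proof (rule inj_onI)
      fix v w assume "v \<in> \<phi> ` (\<lambda>x. x + l1) ` S" "w \<in> \<phi> ` (\<lambda>x. x + l1) ` S" and vw: "\<kappa> v = \<kappa> w"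
      then obtain x x' where x: "x \<in> S" "v = \<phi> (x + l1)" "x' \<in> S" "w = \<phi> (x' + l1)" by blast
      then have "\<Psi> x = \<Psi> x'" using vw \<kappa> by simp
      then have "x = x'" using inj x(1,3) SN unfolding inj_on_def by blast
      then show "v = w" using x by simp
    qed
    moreover have "\<kappa> \<in> (\<phi> ` (\<lambda>x. x + l1) ` S) \<rightarrow> V" unfolding \<kappa>_def using \<Psi>V inv by auto
    ultimately have "openin (top_of_set V) (\<kappa> ` \<phi> ` (\<lambda>x. x + l1) ` S)"
      using invariance_of_domain_subspaces[OF op chart(3) chart(3)] by blast
    then show ?thesis unfolding im .
  qed
  have opU': "openin (top_of_set V) (\<Psi> ` N')" by (rule open_im) simp
  have "openin (top_of_set (\<Psi> ` N')) (\<Psi> ` S)" if S: "openin (top_of_set N') S" for S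
  proof (rule openin_subset_trans[OF open_im[OF S]])
    show "\<Psi> ` S \<subseteq> \<Psi> ` N'" using openin_imp_subset[OF S] by blast
    show "\<Psi> ` N' \<subseteq> V" using \<Psi>V by blast
  qed
  then obtain \<Psi>' where "homeomorphism N' (\<Psi> ` N') \<Psi> \<Psi>'"
    using homeomorphism_injective_open_map[OF cont\<Psi> refl inj] by blast
  then have plh: "pl_homeomorphism N' (\<Psi> ` N') \<Psi> \<Psi>'"
    using \<open>pl_on N' \<Psi>\<close> by (rule pl_homeomorphismI)
  have "\<forall>x\<in>N'. F x = F x\<^sub>0 + B (\<Psi> x)" using B\<Psi> N'(3) by auto
  then show ?thesis using N' opU' plh B(2) BV by blast
qed

section \<open>Preliminaries on manifolds, spans and simplices\<close>

text \<open>By invariance of domain the change from an interior chart to a half-space chart is open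
  into the whole subspace \<open>V'\<close>. Its image contains the point \<open>f' x\<close> of the
  bounding hyperplane, but a small step against the inner normal \<open>a\<close> leaves the
  half-space.\<close>

lemma pl_interior_point_not_boundary:
  fixes X :: "'a::euclidean_space set"
  assumes "pl_interior_point k X x"
  shows "\<not> pl_boundary_point k X x"
proof
  assume "pl_boundary_point k X x"
  then obtain N' V' a U' f' g' where N': "openin (top_of_set X) N'" "x \<in> N'" 
    and V': "subspace (V' :: 'a set)" "dim V' = k" "a \<in> V'" "a \<noteq> 0"
    and U': "openin (top_of_set {v \<in> V'. 0 \<le> a \<bullet> v}) U'"
    and h': "homeomorphism N' U' f' g'" and ax: "a \<bullet> f' x = 0"
    unfolding pl_boundary_point_def pl_homeomorphism_def by (elim exE conjE) (rule that)
  obtain N V U f g where N: "openin (top_of_set X) N" "x \<in> N" and V: "subspace (V :: 'a set)" "dim V = k"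
    and U: "openin (top_of_set V) U" and h: "homeomorphism N U f g"
    using assms unfolding pl_interior_point_def pl_homeomorphism_def by (elim exE conjE) (rule that)
  have U'H: "U' \<subseteq> {v \<in> V'. 0 \<le> a \<bullet> v}" using U' openin_imp_subset by blast
  define S where "S = N \<inter> N'"
  have "openin (top_of_set X) S" unfolding S_def using N N' by blast
  then have "openin (top_of_set N) S"
    by (rule openin_subset_trans) (use N(1) openin_imp_subset S_def in auto)
  then have opU: "openin (top_of_set U) (f ` S)" by (rule homeomorphism_imp_open_map[OF h])
  then have op: "openin (top_of_set V) (f ` S)" using U openin_trans by blast
  define \<kappa> where "\<kappa> w = f' (g w)" for w
  have gS: "g w \<in> S" if "w \<in> f ` S" for w
    using that homeomorphism_apply1[OF h] unfolding S_def by auto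
  have cg: "continuous_on (f ` S) g"
    using homeomorphism_cont2[OF h] openin_imp_subset[OF opU] by (rule continuous_on_subset)
  have "continuous_on (f ` S) \<kappa>"
    unfolding \<kappa>_def
    by (rule continuous_on_compose2[OF homeomorphism_cont1[OF h'] cg]) (use gS S_def in auto)
  moreover have "inj_on \<kappa> (f ` S)"
  proof (rule inj_onI)
    fix v w assume vw: "v \<in> f ` S" "w \<in> f ` S" "\<kappa> v = \<kappa> w"
    then have "g v = g w"
      using gS homeomorphism_apply1[OF h'] unfolding \<kappa>_def S_def by (metis IntD2)
    then show "v = w"
      using vw openin_imp_subset[OF opU] homeomorphism_apply2[OF h] by (metis subsetD)
  qed
  moreover have \<kappa>U: "\<kappa> w \<in> U'" if "w \<in> f ` S" for w
    using gS[OF that] homeomorphism_image1[OF h'] unfolding \<kappa>_def S_def by blast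
  then have "\<kappa> \<in> f ` S \<rightarrow> V'" using U'H by blast
  moreover have "dim V' \<le> dim V" using V(2) V'(2) by simp
  ultimately have opV': "openin (top_of_set V') (\<kappa> ` f ` S)"
    using invariance_of_domain_subspaces[OF op V(1) V'(1)] by blast
  have xS: "x \<in> S" unfolding S_def using N N' by blast
  have "\<kappa> (f x) = f' x" unfolding \<kappa>_def using homeomorphism_apply1[OF h N(2)] by simp
  then have "f' x \<in> \<kappa> ` f ` S" using xS by (metis imageI)
  then obtain e where e: "0 < e" "ball (f' x) e \<inter> V' \<subseteq> \<kappa> ` f ` S"
    using opV' unfolding openin_contains_ball by blast
  have fx: "f' x \<in> V'" using subsetD[OF openin_imp_subset[OF opV'] \<open>f' x \<in> \<kappa> ` f ` S\<close>] .
  obtain t where t: "0 < t" "t *\<^sub>R a \<in> V'" "norm (t *\<^sub>R a) < e"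
    using subspace_small_multiple[OF V'(1,3) e(1)] .
  have "f' x - t *\<^sub>R a \<in> ball (f' x) e \<inter> V'"
    using t fx V'(1) by (simp add: dist_norm subspace_diff)
  then have "f' x - t *\<^sub>R a \<in> \<kappa> ` f ` S" using e(2) by (rule subsetD[rotated])
  then have "f' x - t *\<^sub>R a \<in> U'" using \<kappa>U by (metis imageE)
  then have "0 \<le> a \<bullet> (f' x - t *\<^sub>R a)" using U'H by blast
  then have "t * (a \<bullet> a) \<le> 0" using ax by (simp add: inner_diff_right)
  moreover have "0 < t * (a \<bullet> a)" using t(1) V'(4) by simp
  ultimately show False by simp
qed

text \<open>Rank and nullity relative to a subspace: a right inverse \<open>s\<close> with values in
  \<open>V\<close> splits \<open>V\<close> into the kernel and \<open>s\<close> B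
  \<open>V\<close>.\<close>

lemma dim_kernel_plus_dim_image:
  fixes B :: "'a::euclidean_space \<Rightarrow> 'b::euclidean_space"
  assumes B: "linear B" and V: "subspace V"
  shows "dim {v\<in>V. B v = 0} + dim (B ` V) = dim V"
proof -
  obtain s where s: "s ` UNIV \<subseteq> V" "linear s" "\<forall>v\<in>B ` V. B (s v) = v"
    using linear_exists_right_inverse_on[OF B V] by auto
  define K where "K = {v\<in>V. B v = 0}"
  have K: "subspace K"
    unfolding K_def subspace_def using V
    by (auto simp: subspace_0 subspace_add subspace_scale linear_0[OF B] linear_add[OF B] linear_scale[OF B])
  have R: "subspace (B ` V)" by (rule linear_subspace_image[OF B V])
  then have S: "subspace (s ` B ` V)" by (rule linear_subspace_image[OF s(2)])
  have inj: "inj_on s (span (B ` V))"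
    using s(3) R by (metis inj_on_inverseI span_eq_iff)
  have "K \<inter> s ` B ` V = {0}"
  proof -
    have "w = 0" if "w \<in> K" "w = s v" "v \<in> B ` V" for v w
      using that s(3) linear_0[OF s(2)] unfolding K_def by fastforce
    then show ?thesis using subspace_0[OF K] subspace_0[OF S] by blast
  qed
  moreover have "{x + y |x y. x \<in> K \<and> y \<in> s ` B ` V} = V"
  proof
    show "{x + y |x y. x \<in> K \<and> y \<in> s ` B ` V} \<subseteq> V"
      unfolding K_def using V s(1) by (auto simp: subspace_add image_subset_iff)
    show "V \<subseteq> {x + y |x y. x \<in> K \<and> y \<in> s ` B ` V}"
    proof
      fix v assume v: "v \<in> V"
      have "B (v - s (B v)) = 0" using s(3) v by (simp add: linear_diff[OF B])
      moreover have "v - s (B v) \<in> V" using v V s(1) by (simp add: subspace_diff image_subset_iff)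
      ultimately have "v - s (B v) \<in> K" unfolding K_def by simp
      moreover have "v = (v - s (B v)) + s (B v)" by simp
      ultimately show "v \<in> {x + y |x y. x \<in> K \<and> y \<in> s ` B ` V}" using v by blast
    qed
  qed
  ultimately have "dim V + dim {0::'a} = dim K + dim (s ` B ` V)"
    using dim_sums_Int[OF K S] by simp
  moreover have "dim (s ` B ` V) = dim (B ` V)" by (rule dim_image_eq[OF s(2) inj])
  ultimately show ?thesis unfolding K_def by simp
qed

text \<open>A finite set has finitely many spans of subsets, and the proper ones are null sets, so
  they cannot cover the space.\<close>

lemma exists_avoiding_proper_spans:
  fixes Z\<^sub>0 :: "'a::euclidean_space set"
  assumes "finite Z\<^sub>0"
  shows "\<exists>v. \<forall>Z\<subseteq>Z\<^sub>0. span Z \<noteq> UNIV \<longrightarrow> v \<notin> span Z"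
proof (rule ccontr)
  assume *: "\<not> ?thesis"
  let ?S = "{span Z |Z. Z \<subseteq> Z\<^sub>0 \<and> span Z \<noteq> UNIV}"
  have "?S \<subseteq> span ` Pow Z\<^sub>0" by blast
  then have fin: "finite ?S" using assms by (simp add: finite_subset)
  have "negligible (\<Union>?S)"
  proof (rule negligible_Union[OF fin])
    fix S assume "S \<in> ?S"
    then obtain Z where Z: "S = span Z" "span Z \<noteq> UNIV" by blast
    have "dim Z \<noteq> DIM('a)" using Z(2) dim_eq_full by blast
    then have "dim S < DIM('a)" unfolding Z(1) using dim_subset_UNIV[of Z] by simp
    then show "negligible S" by (rule negligible_lowdim)
  qed
  moreover have "v \<in> \<Union>?S" for v
  proof -
    obtain Z where "Z \<subseteq> Z\<^sub>0" "span Z \<noteq> UNIV" "v \<in> span Z" using * by blast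
    then show ?thesis by (intro UnionI[of "span Z"]) auto
  qed
  then have "\<Union>?S = UNIV" by blast
  ultimately show False by simp
qed

text \<open>The vertices with positive barycentric coordinate span the minimal simplex through the
  point.\<close>

lemma exists_rel_interior_simplex:
  fixes T :: "'b::euclidean_space set set"
  assumes T: "simplicial_complex T" and x: "x \<in> \<Union>T"
  obtains C where "convex hull C \<in> T" "\<not> affine_dependent C" "x \<in> rel_interior (convex hull C)"
proof -
  obtain \<sigma> where \<sigma>: "\<sigma> \<in> T" "x \<in> \<sigma>" using x by blast
  then obtain C where C: "\<not> affine_dependent C" "\<sigma> = convex hull C"
    using T unfolding simplicial_complex_def simplex_def by meson
  have fC: "finite C" using C(1) by (rule aff_independent_finite)
  obtain u where u: "\<forall>v\<in>C. 0 \<le> u v" "sum u C = 1" "(\<Sum>v\<in>C. u v *\<^sub>R v) = x"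
    using \<sigma>(2) unfolding C(2) convex_hull_finite[OF fC] by blast
  define D where "D = {v\<in>C. 0 < u v}"
  have DC: "D \<subseteq> C" unfolding D_def by blast
  have iD: "\<not> affine_dependent D" using C(1) DC affine_independent_subset by blast
  have z: "u v = 0" if "v \<in> C - D" for v using that u(1) unfolding D_def by force
  have "sum u D = 1" using sum.mono_neutral_right[OF fC DC, of u] z u(2) by simp
  moreover have "(\<Sum>v\<in>D. u v *\<^sub>R v) = x"
    using sum.mono_neutral_right[OF fC DC, of "\<lambda>v. u v *\<^sub>R v"] z u(3) by simp
  moreover have "\<forall>v\<in>D. 0 < u v" unfolding D_def by blast
  ultimately have "x \<in> rel_interior (convex hull D)"
    unfolding rel_interior_convex_hull_explicit[OF iD] by blast
  moreover have "convex hull D face_of convex hull C"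
    using face_of_convex_hull_affine_independent[OF C(1)] DC by blast
  then have "convex hull D \<in> T"
    using T \<sigma>(1) C(2) unfolding simplicial_complex_def by blast
  ultimately show thesis using that iD by blast
qed

text \<open>Since \<open>affine_map_on\<close> asks for a linear map of the whole space, the values
  on the independent differences from one vertex \<open>c0\<close> are extended linearly.\<close>

lemma linear_extension_affine:
  fixes T :: "'b::euclidean_space set set" and q :: "'b \<Rightarrow> 'c::euclidean_space"
  assumes T: "simplicial_complex T" and CT: "convex hull C \<in> T" and C: "\<not> affine_dependent C"
  obtains A b where "linear A" "\<And>z. z \<in> convex hull C \<Longrightarrow> linear_extension T q z = A z + b"
    "\<And>c. c \<in> C \<Longrightarrow> q c = A c + b"
proof (cases "C = {}")
  \<comment> \<open>The empty simplex may belong to \<open>T\<close>.\<close>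
  case True
  then show ?thesis using that[of "\<lambda>_. 0" 0] linear_zero by auto
next
  case False
  then obtain c0 where c0: "c0 \<in> C" by blast
  have fC: "finite C" using C by (rule aff_independent_finite)
  have "independent ((\<lambda>x. - c0 + x) ` (C - {c0}))"
    using C affine_dependent_iff_dependent2[OF c0] by blast
  then obtain A where A: "linear A" "\<forall>x\<in>(\<lambda>x. - c0 + x) ` (C - {c0}). A x = q (c0 + x) - q c0"
    using linear_independent_extend[of _ "\<lambda>x. q (c0 + x) - q c0"] by blast
  define b where "b = q c0 - A c0"
  have q: "q c = A c + b" if "c \<in> C" for c
  proof (cases "c = c0")
    case False
    then have "A (- c0 + c) = q c - q c0" using A(2) that by simp
    then have "A c - A c0 = q c - q c0" using linear_diff[OF A(1), of c c0] by simp
    then show ?thesis unfolding b_def by (simp add: algebra_simps)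
  qed (simp add: b_def)
  have "linear_extension T q z = A z + b" if z: "z \<in> convex hull C" for z
  proof -
    obtain u where u: "\<forall>v\<in>C. 0 \<le> u v" "sum u C = 1" "(\<Sum>v\<in>C. u v *\<^sub>R v) = z"
      using z unfolding convex_hull_finite[OF fC] by blast
    have "linear_extension T q z = (\<Sum>v\<in>C. u v *\<^sub>R q v)"
      using linear_extension_eq[OF T CT C _ u(2)] u by blast
    also have "\<dots> = (\<Sum>v\<in>C. u v *\<^sub>R (A v + b))" using q by simp
    also have "\<dots> = (\<Sum>v\<in>C. A (u v *\<^sub>R v)) + sum u C *\<^sub>R b"
      by (simp add: scaleR_add_right sum.distrib scaleR_sum_left linear_scale[OF A(1)])
    also have "\<dots> = A z + b" using u(2,3) linear_sum[OF A(1)] by (metis scaleR_one)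
    finally show ?thesis .
  qed
  then show ?thesis using that A(1) q by blast
qed

lemma continuous_on_linear_extension:
  fixes T :: "'b::euclidean_space set set" and q :: "'b \<Rightarrow> 'c::euclidean_space"
  assumes T: "simplicial_complex T"
  shows "continuous_on (\<Union>T) (linear_extension T q)"
proof -
  have fin: "finite T" and sim: "\<forall>S\<in>T. \<exists>n. n simplex S" using T unfolding simplicial_complex_def by auto
  have "closed S \<and> continuous_on S (linear_extension T q)" if S: "S \<in> T" for S
  proof -
    obtain C where C: "\<not> affine_dependent C" "S = convex hull C"
      using S sim unfolding simplex_def by meson
    obtain A b where A: "linear A" "\<And>z. z \<in> convex hull C \<Longrightarrow> linear_extension T q z = A z + b"
      using linear_extension_affine[OF T, of C q] S C by metis
    have "continuous_on S (\<lambda>z. A z + b)"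
      by (intro continuous_intros linear_continuous_on linear_conv_bounded_linear[THEN iffD1] A(1))
    then have "continuous_on S (linear_extension T q)"
      using A(2) C(2) by (simp cong: continuous_on_cong)
    moreover have "closed S"
      using C aff_independent_finite polytope_convex_hull polytope_imp_closed by blast
    ultimately show ?thesis by blast
  qed
  then show ?thesis using continuous_on_closed_Union[OF fin, of "\<lambda>S. S" "linear_extension T q"] by auto
qed

lemma rel_interior_simplex_translates:
  fixes C :: "'a::euclidean_space set"
  assumes "x \<in> rel_interior (convex hull C)" "c \<in> C"
  obtains \<delta> where "0 < \<delta>"
    "\<And>l. l \<in> span ((\<lambda>z. z - c) ` C) \<Longrightarrow> norm l < \<delta> \<Longrightarrow> x + l \<in> convex hull C"
proof -
  obtain e where e: "0 < e" "ball x e \<inter> affine hull C \<subseteq> convex hull C" and x: "x \<in> convex hull C"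
    using assms(1) unfolding mem_rel_interior_ball by (auto simp: affine_hull_convex_hull)
  have "x + l \<in> convex hull C" if l: "l \<in> span ((\<lambda>z. z - c) ` C)" "norm l < e" for l
  proof -
    have "x \<in> affine hull C" using x convex_hull_subset_affine_hull by blast
    then have "x - c \<in> span ((\<lambda>z. z - c) ` C)"
      using diffs_affine_hull_span[OF assms(2)] by blast
    then have "(x - c) + l \<in> span ((\<lambda>z. z - c) ` C)" using l(1) by (rule span_add)
    then have "(x - c) + l \<in> (\<lambda>z. z - c) ` (affine hull C)"
      using diffs_affine_hull_span[OF assms(2)] by blast
    then obtain z where "z \<in> affine hull C" "(x - c) + l = z - c" by blast
    then have "x + l \<in> affine hull C" by (simp add: algebra_simps)
    moreover have "x + l \<in> ball x e" using l(2) by (simp add: dist_norm)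
    ultimately show ?thesis using e(2) by blast
  qed
  then show thesis using that e(1) by blast
qed

text \<open>The normal vector of a half-space chart has to lie in the chart subspace, so
  \<open>a\<close> is the orthogonal projection of \<open>adjoint B v\<close> to
  \<open>V\<close>.\<close>

lemma linear_functional_on_subspace:
  fixes B :: "'a::euclidean_space \<Rightarrow> 'b::euclidean_space"
  assumes "linear B" "subspace V"
  obtains a where "a \<in> V" "\<And>w. w \<in> V \<Longrightarrow> a \<bullet> w = v \<bullet> B w"
proof -
  obtain y z where yz: "y \<in> span V" "\<forall>w\<in>span V. orthogonal z w" "adjoint B v = y + z"
    using orthogonal_subspace_decomp_exists[of V "adjoint B v"] by metis
  have sp: "span V = V" using assms(2) by (simp add: span_eq_iff)
  have "y \<bullet> w = v \<bullet> B w" if "w \<in> V" for w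
  proof -
    have "v \<bullet> B w = (y + z) \<bullet> w" using adjoint_clauses(2)[OF assms(1)] yz(3) by metis
    moreover have "z \<bullet> w = 0" using yz(2) that sp unfolding orthogonal_def by blast
    ultimately show ?thesis by (simp add: inner_add_left)
  qed
  then show thesis using that yz(1) sp by blast
qed

text \<open>Serves to cut a chart in which a map is linear by a kernel or by a half-space of a
  kernel.\<close>

lemma pl_homeomorphism_restrict_polyhedron:
  assumes "pl_homeomorphism N U f g" "polyhedron Q"
  shows "pl_homeomorphism {z\<in>N. f z \<in> U \<inter> Q} (U \<inter> Q) f g"
proof (rule pl_homeomorphism_vimage[OF assms(1)])
  fix w assume w: "w \<in> U \<inter> Q"
  have "pl_at U g w" using assms(1) w unfolding pl_homeomorphism_def pl_on_iff by blast
  from pl_at_affine[OF this linear_id, of 0] have "pl_at U (\<lambda>z. z) w" by simp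
  then show "pl_at (U \<inter> Q) (\<lambda>z. z) w"
    by (rule pl_at_restrict[OF _ assms(2), of _ _ _ 1]) auto
qed simp

lemma pl_homeomorphism_restrict_open:
  assumes "pl_homeomorphism N U f g" "openin (top_of_set N) N'"
  shows "pl_homeomorphism N' (f ` N') f g" "openin (top_of_set U) (f ` N')"
proof -
  have h: "homeomorphism N U f g" using assms(1) unfolding pl_homeomorphism_def by blast
  show op: "openin (top_of_set U) (f ` N')" using homeomorphism_imp_open_map[OF h assms(2)] .
  have sub: "f ` N' \<subseteq> U" "N' \<subseteq> N" using op assms(2) openin_imp_subset by blast+
  have "pl_homeomorphism {x\<in>N. f x \<in> f ` N'} (f ` N') f g"
  proof (rule pl_homeomorphism_vimage[OF assms(1) sub(1)])
    fix w assume w: "w \<in> f ` N'"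
    then have "pl_at U g w" using assms(1) sub unfolding pl_homeomorphism_def pl_on_iff by blast
    from pl_at_affine[OF this linear_id, of 0] have "pl_at U (\<lambda>z. z) w" by simp
    then show "pl_at (f ` N') (\<lambda>z. z) w" using op w by (rule pl_at_subset_open)
  qed
  moreover have "{x\<in>N. f x \<in> f ` N'} = N'"
    using sub(2) homeomorphism_apply1[OF h] by (auto, metis subsetD)
  ultimately show "pl_homeomorphism N' (f ` N') f g" by simp
qed

section \<open>Regular fibres\<close>

text \<open>\<open>local_straightening\<close> for the simplicial complex, transported to
  \<open>M\<close> by the triangulation. The span condition says that \<open>\<Lambda>\<close>
  composed with the simplexwise linear map is a submersion on the minimal simplex through the point.
  With the identity for \<open>\<Lambda>\<close> it serves points of the fibre, with a projection
  the rest of the ray.\<close>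

lemma regular_chart:
  fixes T :: "'b::euclidean_space set set" and h :: "'b \<Rightarrow> 'a::euclidean_space"
    and q :: "'b \<Rightarrow> 'c::euclidean_space" and \<Lambda> :: "'c \<Rightarrow> 'e::euclidean_space"
  assumes M: "closed_pl_manifold m M" and T: "simplicial_complex T"
    and hg: "pl_homeomorphism (\<Union>T) M h g\<^sub>0" and \<Lambda>: "linear \<Lambda>" and x: "x \<in> M"
    and C: "convex hull C \<in> T" "\<not> affine_dependent C" "g\<^sub>0 x \<in> rel_interior (convex hull C)"
    and c: "c \<in> C" and sp: "span ((\<lambda>z. \<Lambda> (q z - q c)) ` C) = range \<Lambda>"
  shows "\<exists>N V U f g B. openin (top_of_set M) N \<and> x \<in> N \<and> subspace (V :: 'a set) \<and> dim V = m \<and>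
     openin (top_of_set V) U \<and> pl_homeomorphism N U f g \<and> linear B \<and> B ` V = range \<Lambda> \<and>
     (\<forall>z\<in>N. \<Lambda> (linear_extension T q (g\<^sub>0 z)) = \<Lambda> (linear_extension T q (g\<^sub>0 x)) + B (f z))"
proof -
  let ?X = "\<Union>T"
  let ?F = "\<lambda>z. \<Lambda> (linear_extension T q z)"
  have hom: "homeomorphism ?X M h g\<^sub>0" using hg unfolding pl_homeomorphism_def by blast
  have fin: "finite T" and sim: "\<forall>S\<in>T. \<exists>n. n simplex S"
    and face: "\<forall>S S'. S \<in> T \<and> S' \<in> T \<longrightarrow> (S \<inter> S') face_of S"
    using T unfolding simplicial_complex_def by auto
  define x\<^sub>0 where "x\<^sub>0 = g\<^sub>0 x"
  have x0: "x\<^sub>0 \<in> ?X" "h x\<^sub>0 = x"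
    unfolding x\<^sub>0_def using homeomorphism_image2[OF hom] homeomorphism_apply2[OF hom] x by blast+
  have x0C: "x\<^sub>0 \<in> rel_interior (convex hull C)" unfolding x\<^sub>0_def by (rule C(3))
  have Tprops: "polytope \<tau> \<and> affine_map_on \<tau> ?F" if \<tau>: "\<tau> \<in> T" for \<tau>
  proof -
    obtain D where D: "\<not> affine_dependent D" "\<tau> = convex hull D"
      using \<tau> sim unfolding simplex_def by meson
    obtain A b where A: "linear A" "\<And>z. z \<in> convex hull D \<Longrightarrow> linear_extension T q z = A z + b"
      using linear_extension_affine[OF T, of D q] \<tau> D by metis
    then have "affine_map_on \<tau> (linear_extension T q)" unfolding affine_map_on_def D(2) by blast
    moreover have "affine_map_on UNIV (\<lambda>z. \<Lambda> z + 0)" by (rule affine_map_on_linear[OF \<Lambda>])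
    ultimately have "affine_map_on \<tau> ?F" using affine_map_on_compose[of \<tau> _ UNIV] by simp
    then show ?thesis using D aff_independent_finite polytope_convex_hull by blast
  qed
  have contF: "continuous_on ?X ?F"
    by (rule linear_continuous_on_compose[OF continuous_on_linear_extension[OF T] \<Lambda>])
  define E where "E = span ((\<lambda>z. z - c) ` C)"
  have E: "subspace E" unfolding E_def by simp
  obtain \<delta> where \<delta>: "0 < \<delta>" "\<And>l. l \<in> E \<Longrightarrow> norm l < \<delta> \<Longrightarrow> x\<^sub>0 + l \<in> convex hull C"
    using rel_interior_simplex_translates[OF x0C c] unfolding E_def by metis
  \<comment> \<open>A face of the minimal simplex that meets its relative interior is the whole
    simplex. Thus every simplex through \<open>x\<^sub>0\<close> contains the ball of
    \<open>x\<^sub>0 + E\<close>, as the straightening lemma demands.\<close>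
  have star: "convex hull C \<subseteq> \<tau>" if "\<tau> \<in> T" "x\<^sub>0 \<in> \<tau>" for \<tau>
  proof -
    have "convex hull C \<inter> \<tau> face_of convex hull C" using face C(1) that(1) by blast
    moreover have "(convex hull C \<inter> \<tau>) \<inter> rel_interior (convex hull C) \<noteq> {}"
      using x0C that(2) rel_interior_subset by blast
    ultimately have "convex hull C \<subseteq> convex hull C \<inter> \<tau>"
      by (rule subset_of_face_of[OF _ order_refl])
    then show ?thesis by blast
  qed
  obtain A b where A: "linear A" "\<And>z. z \<in> convex hull C \<Longrightarrow> linear_extension T q z = A z + b"
    "\<And>z. z \<in> C \<Longrightarrow> q z = A z + b"
    using linear_extension_affine[OF T C(1,2), of q] by metis
  define G where "G l = \<Lambda> (A l)" for l
  have G: "linear G" unfolding G_def using linear_compose[OF A(1) \<Lambda>] by (simp add: o_def)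
  have GF: "?F (x\<^sub>0 + l) = ?F x\<^sub>0 + G l" if l: "l \<in> E" "norm l < \<delta>" for l
  proof -
    have "linear_extension T q (x\<^sub>0 + l) = linear_extension T q x\<^sub>0 + A l"
      using A(2)[OF \<delta>(2)[OF l]] A(2)[of x\<^sub>0] x0C rel_interior_subset linear_add[OF A(1)] by fastforce
    then show ?thesis unfolding G_def by (simp add: linear_add[OF \<Lambda>])
  qed
  have GE: "G ` E = range \<Lambda>"
  proof -
    have "G ` E = span (G ` (\<lambda>z. z - c) ` C)" unfolding E_def using linear_span_image[OF G] by simp
    also have "G ` (\<lambda>z. z - c) ` C = (\<lambda>z. \<Lambda> (q z - q c)) ` C"
      unfolding image_image G_def
    proof (rule image_cong[OF refl])
      fix z assume "z \<in> C"
      then show "\<Lambda> (A (z - c)) = \<Lambda> (q z - q c)"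
        using A(3)[of z] A(3)[OF c] by (simp add: linear_diff[OF A(1)])
    qed
    finally show ?thesis using sp by simp
  qed
  have FR: "?F z - ?F x\<^sub>0 \<in> range \<Lambda>" for z
    unfolding linear_diff[OF \<Lambda>, symmetric] by blast
  have "pl_interior_point m M x"
    using M x unfolding closed_pl_manifold_def pl_manifold_with_boundary_def pl_boundary_def by blast
  then obtain N1 V U1 f1 g1 where N1: "openin (top_of_set M) N1" "x \<in> N1"
    and V: "subspace (V :: 'a set)" "dim V = m" "openin (top_of_set V) U1"
    and ch: "pl_homeomorphism N1 U1 f1 g1"
    unfolding pl_interior_point_def by (elim exE conjE) (rule that)
  have gh: "pl_homeomorphism M ?X g\<^sub>0 h" using hg by (rule pl_homeomorphism_sym)
  note N2 = pl_homeomorphism_restrict_open[OF gh N1(1)]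
  have ch2: "pl_homeomorphism (g\<^sub>0 ` N1) U1 (\<lambda>x. f1 (h x)) (\<lambda>z. g\<^sub>0 (g1 z))"
    by (rule pl_homeomorphism_compose[OF pl_homeomorphism_sym[OF N2(1)] ch])
  have x0N: "x\<^sub>0 \<in> g\<^sub>0 ` N1" unfolding x\<^sub>0_def using N1(2) by blast
  have "\<exists>N' U' f g B. openin (top_of_set ?X) N' \<and> x\<^sub>0 \<in> N' \<and> openin (top_of_set V) U' \<and>
    pl_homeomorphism N' U' f g \<and> linear B \<and> B ` V = range \<Lambda> \<and> (\<forall>x\<in>N'. ?F x = ?F x\<^sub>0 + B (f x))"
    by (rule local_straightening[OF fin _ _ refl contF x0(1) E \<delta>(1) _ G GF GE FR N2(2) x0N V(1,3) ch2])
      (use Tprops star \<delta>(2) in blast)+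
  then obtain N' U' f g B where N': "openin (top_of_set ?X) N'" "x\<^sub>0 \<in> N'"
    "openin (top_of_set V) U'" "pl_homeomorphism N' U' f g" "linear B" "B ` V = range \<Lambda>"
    "\<forall>x\<in>N'. ?F x = ?F x\<^sub>0 + B (f x)" by (elim exE conjE) (rule that)
  note N3 = pl_homeomorphism_restrict_open[OF hg N'(1)]
  have ch3: "pl_homeomorphism (h ` N') U' (\<lambda>x. f (g\<^sub>0 x)) (\<lambda>z. h (g z))"
    by (rule pl_homeomorphism_compose[OF pl_homeomorphism_sym[OF N3(1)] N'(4)])
  have xN: "x \<in> h ` N'" using N'(2) x0(2) by blast
  have "\<forall>z\<in>h ` N'. ?F (g\<^sub>0 z) = ?F (g\<^sub>0 x) + B (f (g\<^sub>0 z))"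
  proof
    fix z assume "z \<in> h ` N'"
    then obtain w where w: "w \<in> N'" "z = h w" by blast
    then have "g\<^sub>0 z = w" using homeomorphism_apply1[OF hom] openin_imp_subset[OF N'(1)] by blast
    then show "?F (g\<^sub>0 z) = ?F (g\<^sub>0 x) + B (f (g\<^sub>0 z))" using N'(7) w(1) unfolding x\<^sub>0_def by simp
  qed
  then show ?thesis using N3(2) xN V(1,2) N'(3,5,6) ch3 by blast
qed

text \<open>A smallest subset of \<open>D\<close> with \<open>y\<close> in its hull is affinely
  independent by Caratheodory, hence spans a simplex of \<open>cov P y\<close>. That simplex is
  full-dimensional by assumption, so \<open>D\<close> spans the space affinely.\<close>

lemma cov_affine_hull:
  fixes y :: "'a::euclidean_space"
  assumes cov: "\<forall>\<sigma>\<in>cov P y. aff_dim \<sigma> = int DIM('a)" and D: "D \<subseteq> P" "finite D" "y \<in> convex hull D"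
    and d: "d \<in> D"
  shows "span ((\<lambda>z. z - d) ` D) = UNIV"
proof -
  obtain S where S: "S \<subseteq> D \<and> y \<in> convex hull S" and
    min: "\<And>S'. S' \<subseteq> D \<and> y \<in> convex hull S' \<Longrightarrow> card S \<le> card S'"
    using ex_has_least_nat[of "\<lambda>S. S \<subseteq> D \<and> y \<in> convex hull S" D card] D(3) by blast
  have fS: "finite S" using S D(2) finite_subset by blast
  obtain S' where S': "S' \<subseteq> S" "int (card S') \<le> aff_dim S + 1" "y \<in> convex hull S'"
    using S unfolding caratheodory_aff_dim[of S] by blast
  \<comment> \<open>Minimality turns the bound for \<open>S'\<close> into the bound
    \<open>aff_dim S + 1\<close> for \<open>S\<close> itself, which is equality and means
    independence.\<close>
  have "card S \<le> card S'" using min S' S by blast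
  then have "int (card S) \<le> aff_dim S + 1" using S'(2) by linarith
  moreover have "aff_dim S \<le> int (card S) - 1" using aff_dim_le_card[OF fS] .
  ultimately have iS: "\<not> affine_dependent S"
    unfolding affine_independent_iff_card using fS by linarith
  have "S \<noteq> {}" using S by auto
  then have "1 \<le> card S" using fS by (simp add: Suc_leI card_gt_0_iff)
  moreover have "card S \<le> DIM('a) + 1"
    using iS aff_dim_le_DIM[of S] unfolding affine_independent_iff_card by linarith
  ultimately have "convex hull S \<in> cov P y" unfolding cov_def using iS S D(1) by blast
  then have "aff_dim S = int DIM('a)" using cov aff_dim_convex_hull by metis
  then have "aff_dim D = int DIM('a)"
    using aff_dim_subset[of S D] S aff_dim_le_DIM[of D] by linarith
  then have "affine hull D = UNIV" using aff_dim_eq_full by blast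
  then have "span ((\<lambda>z. z - d) ` D) = (\<lambda>z. z - d) ` UNIV"
    using diffs_affine_hull_span[OF d] by simp
  then show ?thesis using surj_diff_right by simp
qed

lemma dim_range_orthogonal_projection:
  fixes v :: "'c::euclidean_space"
  assumes v: "v \<noteq> 0"
  defines "\<Lambda> \<equiv> \<lambda>z. z - ((z \<bullet> v) / (v \<bullet> v)) *\<^sub>R v"
  shows "linear \<Lambda>" "dim (range \<Lambda>) = DIM('c) - 1" "\<And>z. \<Lambda> z = 0 \<Longrightarrow> z \<bullet> v = 0 \<Longrightarrow> z = 0" "\<Lambda> v = 0"
proof -
  have vv: "v \<bullet> v \<noteq> 0" using v by simp
  show lin: "linear \<Lambda>"
    unfolding \<Lambda>_def
    by (rule linearI) (simp_all add: inner_add_left add_divide_distrib scaleR_add_left scaleR_right_diff_distrib)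
  show "z = 0" if "\<Lambda> z = 0" "z \<bullet> v = 0" for z using that unfolding \<Lambda>_def by simp
  show Lv: "\<Lambda> v = 0" unfolding \<Lambda>_def using vv by simp
  have "{z\<in>UNIV. \<Lambda> z = 0} = span {v}"
  proof
    show "{z\<in>UNIV. \<Lambda> z = 0} \<subseteq> span {v}"
      unfolding \<Lambda>_def span_singleton by auto
    show "span {v} \<subseteq> {z\<in>UNIV. \<Lambda> z = 0}"
      unfolding span_singleton using Lv by (auto simp: linear_scale[OF lin])
  qed
  moreover have "dim (span {v}) = 1" using v by (simp add: dim_insert)
  ultimately show "dim (range \<Lambda>) = DIM('c) - 1"
    using dim_kernel_plus_dim_image[OF lin subspace_UNIV] by simp
qed

text \<open>The set \<open>W\<close> is locally a fibre of a submersion to the hyperplane orthogonal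
  to \<open>v\<close>, of dimension \<open>d - 1\<close>, which gives it one dimension more than the
  fibre \<open>S\<close> of \<open>f\<close>.\<close>

lemma fibre_null_cobordant:
  fixes T :: "'b::euclidean_space set set" and h :: "'b \<Rightarrow> 'a::euclidean_space"
    and q :: "'b \<Rightarrow> 'c::euclidean_space"
  assumes cov: "\<forall>\<sigma>\<in>cov P y. aff_dim \<sigma> = int DIM('c)" and P: "finite P" "q ` vertices T \<subseteq> P"
    and M: "closed_pl_manifold m M" and dm: "DIM('c) \<le> m" and T: "simplicial_complex T"
    and hg: "pl_homeomorphism (\<Union>T) M h g\<^sub>0"
  shows "null_cobordant_manifold (m - DIM('c)) {x \<in> M. linear_extension T q (g\<^sub>0 x) = y}"
proof -
  define f where "f x = linear_extension T q (g\<^sub>0 x)" for x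
  have hom: "homeomorphism (\<Union>T) M h g\<^sub>0" using hg unfolding pl_homeomorphism_def by blast
  have contf: "continuous_on M f"
    unfolding f_def
    by (rule continuous_on_compose2[OF continuous_on_linear_extension[OF T] homeomorphism_cont2[OF hom]])
      (use homeomorphism_image2[OF hom] in auto)
  have cM: "compact M" using M unfolding closed_pl_manifold_def by blast
  \<comment> \<open>The point \<open>f x\<close> has the barycentric coordinates of
    \<open>g\<^sub>0 x\<close>, now with respect to the vertex values. Hence it lies in the hull of
    points of \<open>P\<close>, the form in which the assumption on \<open>cov\<close> and the
    choice of \<open>v\<close> apply.\<close>
  have carrier: "\<exists>C c. convex hull C \<in> T \<and> \<not> affine_dependent C \<and> g\<^sub>0 x \<in> rel_interior (convex hull C) \<and>
      c \<in> C \<and> q ` C \<subseteq> P \<and> finite (q ` C) \<and> f x \<in> convex hull (q ` C)" if x: "x \<in> M" for x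
  proof -
    have gx: "g\<^sub>0 x \<in> \<Union>T" using homeomorphism_image2[OF hom] x by blast
    obtain C where C: "convex hull C \<in> T" "\<not> affine_dependent C" "g\<^sub>0 x \<in> rel_interior (convex hull C)"
      using exists_rel_interior_simplex[OF T gx] .
    have gC: "g\<^sub>0 x \<in> convex hull C" using C(3) rel_interior_subset by blast
    then obtain c where c: "c \<in> C" by fastforce
    have fC: "finite C" using C(2) by (rule aff_independent_finite)
    have "{z} \<in> T" if "z \<in> C" for z
    proof -
      have "{z} face_of convex hull C"
        using face_of_convex_hull_affine_independent[OF C(2), of "{z}"] that by (metis convex_hull_singleton empty_subsetI insert_subset)
      then show ?thesis using T C(1) unfolding simplicial_complex_def by blast
    qed
    then have qP: "q ` C \<subseteq> P" using P(2) unfolding vertices_def by blast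
    obtain A b where A: "linear A" "\<And>z. z \<in> convex hull C \<Longrightarrow> linear_extension T q z = A z + b"
      "\<And>z. z \<in> C \<Longrightarrow> q z = A z + b"
      using linear_extension_affine[OF T C(1,2), of q] by metis
    obtain u where u: "\<forall>v\<in>C. 0 \<le> u v" "sum u C = 1" "(\<Sum>v\<in>C. u v *\<^sub>R v) = g\<^sub>0 x"
      using gC unfolding convex_hull_finite[OF fC] by blast
    have "f x = (\<Sum>v\<in>C. u v *\<^sub>R q v)"
      unfolding f_def u(3)[symmetric] using linear_extension_eq[OF T C(1,2) _ u(2)] u(1) by blast
    also have "\<dots> \<in> convex hull (q ` C)"
      using u fC by (intro convex_sum convex_convex_hull) (auto intro: hull_inc)
    finally show ?thesis using C c qP fC by blast
  qed
  \<comment> \<open>The ray from \<open>y\<close> in direction \<open>v\<close> will meet no simplex of dimension less than \<open>d - 1\<close>, and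
    simplices of dimension \<open>d - 1\<close> only transversally.\<close>
  define Z\<^sub>0 where "Z\<^sub>0 = (\<lambda>(a, b). a - b) ` (P \<times> insert y P)"
  have "finite Z\<^sub>0" unfolding Z\<^sub>0_def using P(1) by simp
  then obtain v where gen: "\<And>Z. Z \<subseteq> Z\<^sub>0 \<Longrightarrow> span Z \<noteq> UNIV \<Longrightarrow> v \<notin> span Z"
    using exists_avoiding_proper_spans by metis
  \<comment> \<open>The empty set of differences is among those avoided; its span is the zero space,
    which is proper here.\<close>
  have "v \<noteq> 0"
  proof
    assume "v = 0"
    moreover have "span {} \<noteq> (UNIV :: 'c set)"
      using SOME_Basis nonzero_Basis by (metis UNIV_I singletonD span_empty)
    ultimately show False using gen[of "{}"] span_zero by blast
  qed
  define \<Lambda> where "\<Lambda> z = z - ((z \<bullet> v) / (v \<bullet> v)) *\<^sub>R v" for z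
  note \<Lambda> = dim_range_orthogonal_projection[OF \<open>v \<noteq> 0\<close>, folded \<Lambda>_def]
  define S where "S = {x\<in>M. f x = y}"
  define W where "W = {x\<in>M. \<Lambda> (f x - y) = 0 \<and> 0 \<le> (f x - y) \<bullet> v}"
  have SW: "S \<subseteq> W" unfolding S_def W_def by (auto simp: linear_0[OF \<Lambda>(1)])
  have SW_eq: "x \<in> S" if "x \<in> W" "(f x - y) \<bullet> v = 0" for x
    using \<Lambda>(3)[of "f x - y"] that unfolding W_def S_def by auto

  \<comment> \<open>Linear charts at points of the fibre and of the open ray\<close>
  have chart_S: "\<exists>N V U k k' B. openin (top_of_set M) N \<and> x \<in> N \<and> subspace (V :: 'a set) \<and> dim V = m \<and>
     openin (top_of_set V) U \<and> pl_homeomorphism N U k k' \<and> linear B \<and> B ` V = (UNIV :: 'c set) \<and>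
     (\<forall>z\<in>N. f z = y + B (k z))" if x: "x \<in> S" for x
  proof -
    have xM: "x \<in> M" and fx: "f x = y" using x unfolding S_def by blast+
    obtain C c where C: "convex hull C \<in> T" "\<not> affine_dependent C" "g\<^sub>0 x \<in> rel_interior (convex hull C)"
      "c \<in> C" "q ` C \<subseteq> P" "finite (q ` C)" "f x \<in> convex hull (q ` C)"
      using carrier[OF xM] by blast
    have "span ((\<lambda>z. z - q c) ` q ` C) = UNIV"
      using cov_affine_hull[OF cov C(5,6)] C(4,7) fx by blast
    then have "span ((\<lambda>z. id (q z - q c)) ` C) = range (id :: 'c \<Rightarrow> 'c)"
      by (simp add: image_image)
    from regular_chart[OF M T hg linear_id xM C(1-4) this]
    show ?thesis unfolding f_def[symmetric] fx by simp
  qed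
  have chart_W: "\<exists>N V U k k' B. openin (top_of_set M) N \<and> x \<in> N \<and> subspace (V :: 'a set) \<and> dim V = m \<and>
     openin (top_of_set V) U \<and> pl_homeomorphism N U k k' \<and> linear B \<and> B ` V = range \<Lambda> \<and>
     (\<forall>z\<in>N. \<Lambda> (f z) = \<Lambda> (f x) + B (k z))" if x: "x \<in> W" "0 < (f x - y) \<bullet> v" for x
  proof -
    have xM: "x \<in> M" using x unfolding W_def by blast
    obtain C c where C: "convex hull C \<in> T" "\<not> affine_dependent C" "g\<^sub>0 x \<in> rel_interior (convex hull C)"
      "c \<in> C" "q ` C \<subseteq> P" "finite (q ` C)" "f x \<in> convex hull (q ` C)"
      using carrier[OF xM] by blast
    define Z where "Z = (\<lambda>z. z - q c) ` q ` C"
    have ZZ: "Z \<subseteq> Z\<^sub>0" "insert (q c - y) Z \<subseteq> Z\<^sub>0" unfolding Z_def Z\<^sub>0_def using C(4,5) by auto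
    define t where "t = ((f x - y) \<bullet> v) / (v \<bullet> v)"
    have t: "0 < t" "f x - y = t *\<^sub>R v"
      using x \<open>v \<noteq> 0\<close> unfolding t_def W_def \<Lambda>_def by auto
    have "f x \<in> affine hull (q ` C)" using C(7) convex_hull_subset_affine_hull by blast
    then have "f x - q c \<in> span Z"
      unfolding Z_def using diffs_affine_hull_span[of "q c" "q ` C"] C(4) by blast
    then have "(f x - q c) + (q c - y) \<in> span (insert (q c - y) Z)"
      by (meson insertI1 span_add span_base span_mono subset_insertI subsetD)
    then have "t *\<^sub>R v \<in> span (insert (q c - y) Z)" using t(2) by simp
    then have "inverse t *\<^sub>R t *\<^sub>R v \<in> span (insert (q c - y) Z)" by (rule span_scale)
    then have vH: "v \<in> span (insert (q c - y) Z)" using t(1) by simp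
    \<comment> \<open>Since \<open>f x\<close> lies in the affine hull of the labels and
      \<open>f x - y\<close> is a positive multiple of \<open>v\<close>, this span contains
      \<open>v\<close>. By the choice of \<open>v\<close> it cannot be proper.\<close>
    then have H: "span (insert (q c - y) Z) = UNIV" using gen ZZ(2) by blast
    have full: "span (insert v Z) = UNIV"
    proof (cases "span Z = UNIV")
      case True
      then show ?thesis using span_mono[of Z "insert v Z"] by blast
    next
      case False
      then have "v \<notin> span Z" using gen ZZ(1) by blast
      \<comment> \<open>Exchange of \<open>q c - y\<close> against \<open>v\<close>. The projection
        along \<open>v\<close> then maps \<open>Z\<close> to a spanning set of its range.\<close>
      then have "q c - y \<in> span (insert v Z)" using vH by (rule in_span_insert[rotated])
      moreover have "Z \<subseteq> span (insert v Z)" using span_superset by blast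
      ultimately have "span (insert (q c - y) Z) \<subseteq> span (insert v Z)"
        by (intro span_minimal) auto
      then show ?thesis using H by blast
    qed
    have "range \<Lambda> = \<Lambda> ` span (insert v Z)" using full by simp
    also have "\<dots> = span (insert 0 (\<Lambda> ` Z))" using linear_span_image[OF \<Lambda>(1), of "insert v Z"] \<Lambda>(4) by simp
    also have "\<dots> = span (\<Lambda> ` Z)" by simp
    also have "\<Lambda> ` Z = (\<lambda>z. \<Lambda> (q z - q c)) ` C" unfolding Z_def by (simp add: image_image)
    finally have "span ((\<lambda>z. \<Lambda> (q z - q c)) ` C) = range \<Lambda>" by simp
    from regular_chart[OF M T hg \<Lambda>(1) xM C(1-4) this]
    show ?thesis unfolding f_def[symmetric] .
  qed

  \<comment> \<open>The fibre as a closed manifold\<close>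
  have closed_S: "closed_pl_manifold (m - DIM('c)) S"
  proof -
    have ip: "pl_interior_point (m - DIM('c)) S x" if x: "x \<in> S" for x
    proof -
      obtain N V U k k' B where N: "openin (top_of_set M) N" "x \<in> N" and V: "subspace (V :: 'a set)" "dim V = m"
        and U: "openin (top_of_set V) U" and k: "pl_homeomorphism N U k k'" 
        and B: "linear B" "B ` V = (UNIV :: 'c set)" "\<forall>z\<in>N. f z = y + B (k z)"
        using chart_S[OF x] by (elim exE conjE) (rule that)
      define V0 where "V0 = {w\<in>V. B w = 0}"
      have UV: "U \<subseteq> V" using U openin_imp_subset by blast
      have NM: "N \<subseteq> M" using N openin_imp_subset by blast
      have kU: "k z \<in> U" if "z \<in> N" for z
        using that k homeomorphism_image1 unfolding pl_homeomorphism_def by blast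
      have lin0: "subspace {w. B w = 0}" using B(1) by (rule linear_subspace_kernel)
      have sub: "subspace V0" unfolding V0_def using subspace_inter[OF V(1) lin0] by (simp add: Int_def)
      have dim: "dim V0 = m - DIM('c)"
        using dim_kernel_plus_dim_image[OF B(1) V(1)] B(2) V(2) unfolding V0_def by simp
      have "pl_homeomorphism {z\<in>N. k z \<in> U \<inter> {w. B w = 0}} (U \<inter> {w. B w = 0}) k k'"
        by (rule pl_homeomorphism_restrict_polyhedron[OF k affine_imp_polyhedron[OF subspace_imp_affine[OF lin0]]])
      moreover have "{z\<in>N. k z \<in> U \<inter> {w. B w = 0}} = S \<inter> N"
        unfolding S_def using B(3) kU NM by auto
      moreover have "U \<inter> {w. B w = 0} = V0 \<inter> U" unfolding V0_def using UV by blast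
      ultimately have ph: "pl_homeomorphism (S \<inter> N) (V0 \<inter> U) k k'" by simp
      have "openin (top_of_set S) (S \<inter> N)"
        using N(1) unfolding S_def openin_open by auto
      moreover have "openin (top_of_set V0) (V0 \<inter> U)"
        using U unfolding V0_def openin_open by auto
      moreover have "x \<in> S \<inter> N" using x N by blast
      ultimately show ?thesis unfolding pl_interior_point_def using sub dim ph by blast
    qed
    have "closed S"
      unfolding S_def using continuous_closed_preimage_constant[OF contf compact_imp_closed[OF cM]] by simp
    then have "compact S" using cM compact_Int_closed[of M S] unfolding S_def by (simp add: Int_absorb1 Collect_conj_eq Int_absorb2 inf_assoc)
    then show ?thesis
      unfolding closed_pl_manifold_def pl_manifold_with_boundary_def pl_boundary_def
      using ip pl_interior_point_not_boundary by blast
  qed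
  \<comment> \<open>The natural subtractions match because \<open>DIM('c)\<close> is positive and at
    most \<open>m\<close>.\<close>
  have dimR: "m - dim (range \<Lambda>) = m - DIM('c) + 1"
    using \<Lambda>(2) dm DIM_positive[where 'a='c] by simp
  have W_int: "pl_interior_point (m - DIM('c) + 1) W x" if x: "x \<in> W" "0 < (f x - y) \<bullet> v" for x
  proof -
    obtain N V U k k' B where N: "openin (top_of_set M) N" "x \<in> N" and V: "subspace (V :: 'a set)" "dim V = m"
      and U: "openin (top_of_set V) U" and k: "pl_homeomorphism N U k k'" 
      and B: "linear B" "B ` V = range \<Lambda>" "\<forall>z\<in>N. \<Lambda> (f z) = \<Lambda> (f x) + B (k z)"
      using chart_W[OF x] by (elim exE conjE) (rule that)
    \<comment> \<open>On this smaller neighbourhood the inequality in the definition of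
      \<open>W\<close> holds strictly, so \<open>W\<close> is cut out by the linear equation
      alone.\<close>
    define N' where "N' = N \<inter> {z\<in>M. 0 < (f z - y) \<bullet> v}"
    have NM: "N \<subseteq> M" using N openin_imp_subset by blast
    have "openin (top_of_set M) (M \<inter> (\<lambda>z. (f z - y) \<bullet> v) -` {0<..})"
      by (rule continuous_openin_preimage_gen[OF _ open_greaterThan]) (intro continuous_intros contf)
    moreover have "M \<inter> (\<lambda>z. (f z - y) \<bullet> v) -` {0<..} = {z\<in>M. 0 < (f z - y) \<bullet> v}" by auto
    ultimately have opN': "openin (top_of_set M) N'" unfolding N'_def using N(1) openin_Int by fastforce
    then have "openin (top_of_set N) N'"
      by (rule openin_subset_trans) (use NM N'_def in auto)
    note k2 = pl_homeomorphism_restrict_open[OF k this]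
    define U' where "U' = k ` N'"
    have opU': "openin (top_of_set V) U'" unfolding U'_def using openin_trans[OF k2(2) U] .
    have UV: "U' \<subseteq> V" using opU' openin_imp_subset by blast
    define V0 where "V0 = {w\<in>V. B w = 0}"
    have lin0: "subspace {w. B w = 0}" using B(1) by (rule linear_subspace_kernel)
    have sub: "subspace V0" unfolding V0_def using subspace_inter[OF V(1) lin0] by (simp add: Int_def)
    have dim: "dim V0 = m - DIM('c) + 1"
      using dim_kernel_plus_dim_image[OF B(1) V(1)] V(2) unfolding V0_def B(2) dimR[symmetric] by simp
    have "pl_homeomorphism {z\<in>N'. k z \<in> U' \<inter> {w. B w = 0}} (U' \<inter> {w. B w = 0}) k k'"
      unfolding U'_def
      by (rule pl_homeomorphism_restrict_polyhedron[OF k2(1) affine_imp_polyhedron[OF subspace_imp_affine[OF lin0]]])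
    moreover have "{z\<in>N'. k z \<in> U' \<inter> {w. B w = 0}} = W \<inter> N'"
    proof -
      have "B (k z) = 0 \<longleftrightarrow> \<Lambda> (f z - y) = 0" if "z \<in> N'" for z
        using B(3) that x(1) unfolding N'_def W_def by (auto simp: linear_diff[OF \<Lambda>(1)])
      then show ?thesis unfolding W_def U'_def by (auto simp: N'_def)
    qed
    moreover have "U' \<inter> {w. B w = 0} = V0 \<inter> U'" unfolding V0_def using UV by blast
    ultimately have ph: "pl_homeomorphism (W \<inter> N') (V0 \<inter> U') k k'" by simp
    have "openin (top_of_set W) (W \<inter> N')"
      using opN' unfolding W_def openin_open by auto
    moreover have "openin (top_of_set V0) (V0 \<inter> U')"
      using opU' unfolding V0_def openin_open by auto
    moreover have "x \<in> W \<inter> N'" using x N(2) unfolding N'_def W_def by blast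
    ultimately show ?thesis unfolding pl_interior_point_def using sub dim ph by blast
  qed
  \<comment> \<open>Here \<open>f z - y = B (k z)\<close>, so in the chart \<open>W\<close> is given
    by \<open>\<Lambda> (B w) = 0\<close> and \<open>0 \<le> v \<bullet> B w\<close>. The first
    condition defines the subspace \<open>V1\<close>, the second one a half-space in it.\<close>
  have W_bd: "pl_boundary_point (m - DIM('c) + 1) W x" if x: "x \<in> S" for x
  proof -
    obtain N V U k k' B where N: "openin (top_of_set M) N" "x \<in> N" and V: "subspace (V :: 'a set)" "dim V = m"
      and U: "openin (top_of_set V) U" and k: "pl_homeomorphism N U k k'" 
      and B: "linear B" "B ` V = (UNIV :: 'c set)" "\<forall>z\<in>N. f z = y + B (k z)"
      using chart_S[OF x] by (elim exE conjE) (rule that)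
    have UV: "U \<subseteq> V" using U openin_imp_subset by blast
    have NM: "N \<subseteq> M" using N openin_imp_subset by blast
    have kU: "k z \<in> U" if "z \<in> N" for z
      using that k homeomorphism_image1 unfolding pl_homeomorphism_def by blast
    have linLB: "linear (\<lambda>w. \<Lambda> (B w))" using linear_compose[OF B(1) \<Lambda>(1)] by (simp add: o_def)
    have lin0: "subspace {w. \<Lambda> (B w) = 0}" using linLB by (rule linear_subspace_kernel)
    define V1 where "V1 = {w\<in>V. \<Lambda> (B w) = 0}"
    have sub: "subspace V1" unfolding V1_def using subspace_inter[OF V(1) lin0] by (simp add: Int_def)
    have "(\<lambda>w. \<Lambda> (B w)) ` V = range \<Lambda>" using B(2) by (metis image_image)
    then have dim: "dim V1 = m - DIM('c) + 1"
      using dim_kernel_plus_dim_image[OF linLB V(1)] V(2) unfolding V1_def dimR[symmetric] by simp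
    obtain a where a: "a \<in> V1" "\<And>w. w \<in> V1 \<Longrightarrow> a \<bullet> w = v \<bullet> B w"
      using linear_functional_on_subspace[OF B(1) sub, of v] by metis
    \<comment> \<open>As \<open>B\<close> is onto, \<open>v\<close> has a preimage in
      \<open>V1\<close>, on which the functional takes the value
      \<open>v \<bullet> v\<close>.\<close>
    have "a \<noteq> 0"
    proof
      assume a0: "a = 0"
      obtain w where w: "w \<in> V" "B w = v" using B(2) by (metis UNIV_I imageE)
      then have "w \<in> V1" unfolding V1_def using \<Lambda>(4) by simp
      then have "v \<bullet> v = 0" using a(2)[of w] a0 w(2) by simp
      then show False using \<open>v \<noteq> 0\<close> by simp
    qed
    define Q where "Q = {w. \<Lambda> (B w) = 0} \<inter> {w. 0 \<le> a \<bullet> w}"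
    define H where "H = {w\<in>V1. 0 \<le> a \<bullet> w}"
    have "polyhedron Q"
      unfolding Q_def
      by (intro polyhedron_Int affine_imp_polyhedron[OF subspace_imp_affine[OF lin0]] polyhedron_halfspace_ge)
    then have "pl_homeomorphism {z\<in>N. k z \<in> U \<inter> Q} (U \<inter> Q) k k'"
      by (rule pl_homeomorphism_restrict_polyhedron[OF k])
    moreover have "{z\<in>N. k z \<in> U \<inter> Q} = W \<inter> N"
    proof -
      have "k z \<in> Q \<longleftrightarrow> \<Lambda> (f z - y) = 0 \<and> 0 \<le> (f z - y) \<bullet> v" if "z \<in> N" for z
      proof -
        have "f z - y = B (k z)" using B(3) that by simp
        moreover have "k z \<in> V" using kU[OF that] UV by blast
        ultimately show ?thesis
          unfolding Q_def using a(2)[of "k z"] unfolding V1_def by (auto simp: inner_commute)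
      qed
      then show ?thesis unfolding W_def using kU NM by auto
    qed
    moreover have "U \<inter> Q = H \<inter> U" unfolding H_def Q_def V1_def using UV by blast
    ultimately have ph: "pl_homeomorphism (W \<inter> N) (H \<inter> U) k k'" by simp
    have "openin (top_of_set W) (W \<inter> N)"
      using N(1) unfolding W_def openin_open by auto
    moreover have "openin (top_of_set {w\<in>V1. 0 \<le> a \<bullet> w}) (H \<inter> U)"
      using U unfolding H_def V1_def openin_open by auto
    moreover have "x \<in> W \<inter> N" using x SW N by blast
    moreover have "a \<bullet> k x = 0"
    proof -
      have "B (k x) = 0" using B(3) N(2) x unfolding S_def by auto
      moreover have "k x \<in> V" using kU[OF N(2)] UV by blast
      ultimately show ?thesis using a(2)[of "k x"] unfolding V1_def by (simp add: linear_0[OF \<Lambda>(1)])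
    qed
    ultimately show ?thesis unfolding pl_boundary_point_def using sub dim a(1) \<open>a \<noteq> 0\<close> ph by blast
  qed
  have pos: "x \<in> S \<or> 0 < (f x - y) \<bullet> v" if "x \<in> W" for x
    using SW_eq[OF that] that unfolding W_def by force
  have "pl_manifold_with_boundary (m - DIM('c) + 1) W"
    unfolding pl_manifold_with_boundary_def using pos W_int W_bd by blast
  moreover have "pl_boundary (m - DIM('c) + 1) W = S"
    unfolding pl_boundary_def
    using pos W_int W_bd pl_interior_point_not_boundary SW by blast
  moreover have "compact W"
  proof -
    have "closed (M \<inter> (\<lambda>z. \<Lambda> (f z - y)) -` {0})"
      by (intro continuous_closed_preimage linear_continuous_on_compose[OF _ \<Lambda>(1)] continuous_intros contf
          compact_imp_closed[OF cM] closed_singleton)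
    moreover have "closed (M \<inter> (\<lambda>z. (f z - y) \<bullet> v) -` {0..})"
      by (intro continuous_closed_preimage continuous_intros contf compact_imp_closed[OF cM] closed_atLeast)
    ultimately have "closed ((M \<inter> (\<lambda>z. \<Lambda> (f z - y)) -` {0}) \<inter> (M \<inter> (\<lambda>z. (f z - y) \<bullet> v) -` {0..}))"
      by (rule closed_Int)
    then have "compact (M \<inter> ((M \<inter> (\<lambda>z. \<Lambda> (f z - y)) -` {0}) \<inter> (M \<inter> (\<lambda>z. (f z - y) \<bullet> v) -` {0..})))"
      using cM by (rule compact_Int_closed[rotated])
    moreover have "M \<inter> ((M \<inter> (\<lambda>z. \<Lambda> (f z - y)) -` {0}) \<inter> (M \<inter> (\<lambda>z. (f z - y) \<bullet> v) -` {0..})) = W"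
      unfolding W_def by auto
    ultimately show ?thesis by simp
  qed
  ultimately show ?thesis
    unfolding null_cobordant_manifold_def using closed_S unfolding S_def f_def by blast
qed

theorem theorem6p1:
  fixes p :: "nat \<Rightarrow> real ^ 'd" and y :: "real ^ 'd" and n m :: nat
    and M :: "'a::euclidean_space set"
    and T :: "'b::euclidean_space set set" and h :: "'b \<Rightarrow> 'a" and L :: "'b \<Rightarrow> nat"
  assumes "\<forall>\<sigma>\<in>cov (p ` {1..n}) y. aff_dim \<sigma> = int CARD('d)"
    and "closed_pl_manifold m M" and "CARD('d) \<le> m"
    and "pl_triangulation T h M"
    and "L \<in> vertices T \<rightarrow> {1..n}"
  shows "null_cobordant_manifold (m - CARD('d)) {x \<in> M. label_map T h L p x = y}"
proof -
  obtain g where T: "simplicial_complex T" and hg: "pl_homeomorphism (\<Union>T) M h g"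
    using assms(4) unfolding pl_triangulation_def by blast
  have hom: "homeomorphism (\<Union>T) M h g" using hg unfolding pl_homeomorphism_def by blast
  \<comment> \<open>\<open>label_map\<close> refers to \<open>inv_into\<close>; on \<open>M\<close>
    this is the continuous inverse that the triangulation provides.\<close>
  have "inv_into (\<Union>T) h x = g x" if "x \<in> M" for x
  proof (rule inv_into_f_eq)
    show "inj_on h (\<Union>T)" using homeomorphism_apply1[OF hom] by (rule inj_on_inverseI)
    show "g x \<in> \<Union>T" using homeomorphism_image2[OF hom] that by blast
    show "h (g x) = x" using homeomorphism_apply2[OF hom that] .
  qed
  then have eq: "{x \<in> M. label_map T h L p x = y} =
      {x \<in> M. linear_extension T (\<lambda>v. p (L v)) (g x) = y}"
    unfolding label_map_def by auto
  have "(\<lambda>v. p (L v)) ` vertices T \<subseteq> p ` {1..n}" using assms(5) by blast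
  then show ?thesis
    unfolding eq using fibre_null_cobordant[of "p ` {1..n}" y _ T m M h g] assms(1-3) T hg by simp
qed

end
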